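(* Let $L$ be a Lie algebra over a field $\mathbb{k}$, let $X=\mathbb{k}\oplus L$ with comultiplication $\Delta$ and ternary operation $T$ as in the context, and let $R: X^{\otimes 2}\otimes X^{\otimes 2}\to X^{\otimes 2}\otimes X^{\otimes 2}$ be the linear map $$R(x\otimes y\otimes z\otimes w)= z^{(1)}\otimes w^{(1)}\otimes T(x\otimes z^{(2)}\otimes w^{(2)})\otimes T(y\otimes z^{(3)}\otimes w^{(3)}),\qquad x,y,z,w\in X.$$ Then $R$ is invertible. Therefore $R$ is a Yang-Baxter operator.
   Context: All tensor products are over $\mathbb{k}$. Elements of $X=\mathbb{k}\oplus L$ are written as pairs $(a,x)$ with $a\in\mathbb{k}$, $x\in L$. The coalgebra structure on $X$ is the linear maps $$\Delta(a,x)=(a,x)\otimes(1,0)+(1,0)\otimes(0,x),\qquad \epsilon(a,x)=a.$$ $\Delta_3=(\mathbf 1\otimes\Delta)\circ\Delta: X\to X^{\otimes 3}$ and Sweedler notation $\Delta_3(z)=z^{(1)}\otimes z^{(2)}\otimes z^{(3)}$ (sum understood) is used. The ternary operation $T:X\otimes X\otimes X\to X$ is the linear map $$T((a,x)\otimes(b,y)\otimes(c,z))=(abc,\ bcx+c[x,y]+b[x,z]+[[x,y],z]).$$ For a vector space $V$, a Yang-Baxter operator is an invertible linear map $R:V\otimes V\to V\otimes V$ with $(R\otimes \mathbf 1)(\mathbf 1\otimes R)(R\otimes \mathbf 1)=(\mathbf 1\otimes R)(R\otimes \mathbf 1)(\mathbf 1\otimes R)$; here $V=X^{\otimes 2}$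 and $\mathbf 1$ is the identity of $V$. *)

theory Defs
  imports "HOL-Algebra.AbelCoset" "Jordan_Normal_Form.Missing_VectorSpace"
begin

section \<open>Tensor products of vector spaces\<close>

definition free_space :: "('k, 'm) ring_scheme \<Rightarrow> 's set \<Rightarrow> ('k, 's \<Rightarrow> 'k) module" where
  "free_space K S = (ring.func_space K S)
     \<lparr>carrier := {f \<in> carrier (ring.func_space K S). finite {s \<in> S. f s \<noteq> \<zero>\<^bsub>K\<^esub>}}\<rparr>"

definition free_gen :: "('k, 'm) ring_scheme \<Rightarrow> 's set \<Rightarrow> 's \<Rightarrow> 's \<Rightarrow> 'k" where
  "free_gen K S s = (\<lambda>t\<in>S. if t = s then \<one>\<^bsub>K\<^esub> else \<zero>\<^bsub>K\<^esub>)"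

text \<open>The ring operations \<open>mult\<close> and \<open>one\<close> of a module record carry no meaning; they are
  filled with the zero coset.\<close>

definition quotient_space ::
  "('k, 'v, 'n) module_scheme \<Rightarrow> 'v set \<Rightarrow> ('k, 'v set) module" where
  "quotient_space M N =
     \<lparr>carrier = a_rcosets\<^bsub>M\<^esub> N,
      mult = (\<lambda>A B. N),
      one = N,
      zero = N,
      add = (\<lambda>A B. A <+>\<^bsub>M\<^esub> B),
      smult = (\<lambda>c A. \<Union>v\<in>A. N +>\<^bsub>M\<^esub> (c \<odot>\<^bsub>M\<^esub> v))\<rparr>"

definition tensor_relations ::
  "('k, 'm) ring_scheme \<Rightarrow> ('k, 'v, 'n1) module_scheme \<Rightarrow> ('k, 'w, 'n2) module_scheme
    \<Rightarrow> ('v \<times> 'w \<Rightarrow> 'k) set" where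
  "tensor_relations K V W =
    (let F = free_space K (carrier V \<times> carrier W);
         g = (\<lambda>v w. free_gen K (carrier V \<times> carrier W) (v, w))
     in {g (v \<oplus>\<^bsub>V\<^esub> v') w \<ominus>\<^bsub>F\<^esub> (g v w \<oplus>\<^bsub>F\<^esub> g v' w) | v v' w.
           v \<in> carrier V \<and> v' \<in> carrier V \<and> w \<in> carrier W} \<union>
        {g v (w \<oplus>\<^bsub>W\<^esub> w') \<ominus>\<^bsub>F\<^esub> (g v w \<oplus>\<^bsub>F\<^esub> g v w') | v w w'.
           v \<in> carrier V \<and> w \<in> carrier W \<and> w' \<in> carrier W} \<union>
        {g (c \<odot>\<^bsub>V\<^esub> v) w \<ominus>\<^bsub>F\<^esub> (c \<odot>\<^bsub>F\<^esub> g v w) | c v w.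
           c \<in> carrier K \<and> v \<in> carrier V \<and> w \<in> carrier W} \<union>
        {g v (c \<odot>\<^bsub>W\<^esub> w) \<ominus>\<^bsub>F\<^esub> (c \<odot>\<^bsub>F\<^esub> g v w) | c v w.
           c \<in> carrier K \<and> v \<in> carrier V \<and> w \<in> carrier W})"

definition tensor_null ::
  "('k, 'm) ring_scheme \<Rightarrow> ('k, 'v, 'n1) module_scheme \<Rightarrow> ('k, 'w, 'n2) module_scheme
    \<Rightarrow> ('v \<times> 'w \<Rightarrow> 'k) set" where
  "tensor_null K V W =
     module.span K (free_space K (carrier V \<times> carrier W)) (tensor_relations K V W)"

definition tensor_space ::
  "('k, 'm) ring_scheme \<Rightarrow> ('k, 'v, 'n1) module_scheme \<Rightarrow> ('k, 'w, 'n2) module_scheme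
    \<Rightarrow> ('k, ('v \<times> 'w \<Rightarrow> 'k) set) module" where
  "tensor_space K V W =
     quotient_space (free_space K (carrier V \<times> carrier W)) (tensor_null K V W)"

definition tensor ::
  "('k, 'm) ring_scheme \<Rightarrow> ('k, 'v, 'n1) module_scheme \<Rightarrow> ('k, 'w, 'n2) module_scheme
    \<Rightarrow> 'v \<Rightarrow> 'w \<Rightarrow> ('v \<times> 'w \<Rightarrow> 'k) set" where
  "tensor K V W v w =
     tensor_null K V W +>\<^bsub>free_space K (carrier V \<times> carrier W)\<^esub>
       free_gen K (carrier V \<times> carrier W) (v, w)"

text \<open>For a bilinear \<open>B\<close>, the following is the linear map on \<open>V \<otimes> W\<close> with values in \<open>Z\<close>
  that sends \<open>v \<otimes> w\<close> to \<open>B v w\<close>: the linear extension of \<open>B\<close> to the free space takes one and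
  the same value on all representatives of a coset, and this value is returned. It is only
  meaningful for bilinear \<open>B\<close>.\<close>

definition tensor_lift ::
  "('k, 'm) ring_scheme \<Rightarrow> ('k, 'v, 'n1) module_scheme \<Rightarrow> ('k, 'w, 'n2) module_scheme
    \<Rightarrow> ('k, 'z, 'n3) module_scheme \<Rightarrow> ('v \<Rightarrow> 'w \<Rightarrow> 'z) \<Rightarrow> ('v \<times> 'w \<Rightarrow> 'k) set \<Rightarrow> 'z" where
  "tensor_lift K V W Z B A =
     the_elem ((\<lambda>f. \<Oplus>\<^bsub>Z\<^esub>p\<in>{p \<in> carrier V \<times> carrier W. f p \<noteq> \<zero>\<^bsub>K\<^esub>}.
                      f p \<odot>\<^bsub>Z\<^esub> B (fst p) (snd p)) ` A)"

definition tensor_map ::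
  "('k, 'm) ring_scheme \<Rightarrow> ('k, 'v, 'n1) module_scheme \<Rightarrow> ('k, 'w, 'n2) module_scheme
    \<Rightarrow> ('k, 'v1, 'n3) module_scheme \<Rightarrow> ('k, 'w1, 'n4) module_scheme
    \<Rightarrow> ('v \<Rightarrow> 'v1) \<Rightarrow> ('w \<Rightarrow> 'w1) \<Rightarrow> ('v \<times> 'w \<Rightarrow> 'k) set \<Rightarrow> ('v1 \<times> 'w1 \<Rightarrow> 'k) set" where
  "tensor_map K V W V1 W1 f g =
     tensor_lift K V W (tensor_space K V1 W1) (\<lambda>v w. tensor K V1 W1 (f v) (g w))"

text \<open>The associator \<open>U \<otimes> (V \<otimes> W) \<rightarrow> (U \<otimes> V) \<otimes> W\<close> and its inverse.\<close>

definition assoc_left ::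
  "('k, 'm) ring_scheme \<Rightarrow> ('k, 'u, 'n1) module_scheme \<Rightarrow> ('k, 'v, 'n2) module_scheme
    \<Rightarrow> ('k, 'w, 'n3) module_scheme
    \<Rightarrow> ('u \<times> ('v \<times> 'w \<Rightarrow> 'k) set \<Rightarrow> 'k) set \<Rightarrow> (('u \<times> 'v \<Rightarrow> 'k) set \<times> 'w \<Rightarrow> 'k) set" where
  "assoc_left K U V W =
    (let Z = tensor_space K (tensor_space K U V) W
     in tensor_lift K U (tensor_space K V W) Z
          (\<lambda>u. tensor_lift K V W Z
            (\<lambda>v w. tensor K (tensor_space K U V) W (tensor K U V u v) w)))"

definition assoc_right ::
  "('k, 'm) ring_scheme \<Rightarrow> ('k, 'u, 'n1) module_scheme \<Rightarrow> ('k, 'v, 'n2) module_scheme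
    \<Rightarrow> ('k, 'w, 'n3) module_scheme
    \<Rightarrow> (('u \<times> 'v \<Rightarrow> 'k) set \<times> 'w \<Rightarrow> 'k) set \<Rightarrow> ('u \<times> ('v \<times> 'w \<Rightarrow> 'k) set \<Rightarrow> 'k) set" where
  "assoc_right K U V W =
    (let Z = tensor_space K U (tensor_space K V W)
     in tensor_lift K (tensor_space K U V) W Z
          (\<lambda>t w. tensor_lift K U V Z
            (\<lambda>u v. tensor K U (tensor_space K V W) u (tensor K V W v w)) t))"

section \<open>Yang-Baxter operators\<close>

definition invertible_linear_map ::
  "('k, 'm) ring_scheme \<Rightarrow> ('k, 'v, 'n1) module_scheme \<Rightarrow> ('k, 'w, 'n2) module_scheme
    \<Rightarrow> ('v \<Rightarrow> 'w) \<Rightarrow> bool" where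
  "invertible_linear_map K V W f \<longleftrightarrow>
     linear_map K V W f \<and>
     (\<exists>g. linear_map K W V g \<and>
          (\<forall>v\<in>carrier V. g (f v) = v) \<and> (\<forall>w\<in>carrier W. f (g w) = w))"

text \<open>\<open>V \<otimes> V \<otimes> V\<close> is read as \<open>V \<otimes> (V \<otimes> V)\<close>; so \<open>R \<otimes> 1\<close>, which lives on
  \<open>(V \<otimes> V) \<otimes> V\<close>, is transported along the associator.\<close>

definition yang_baxter_operator ::
  "('k, 'm) ring_scheme \<Rightarrow> ('k, 'v, 'n) module_scheme
    \<Rightarrow> (('v \<times> 'v \<Rightarrow> 'k) set \<Rightarrow> ('v \<times> 'v \<Rightarrow> 'k) set) \<Rightarrow> bool" where
  "yang_baxter_operator K V R \<longleftrightarrow>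
    (let V2 = tensor_space K V V;
         R1 = assoc_right K V V V \<circ> tensor_map K V2 V V2 V R id \<circ> assoc_left K V V V;
         R2 = tensor_map K V V2 V V2 id R
     in invertible_linear_map K V2 V2 R \<and>
        (\<forall>t\<in>carrier (tensor_space K V V2). R1 (R2 (R1 t)) = R2 (R1 (R2 t))))"

section \<open>Lie algebras and the operator \<open>R\<close>\<close>

locale lie_algebra = vectorspace K L for K (structure) and L (structure) +
  fixes br :: "'c \<Rightarrow> 'c \<Rightarrow> 'c"
  assumes br_closed: "x \<in> carrier L \<Longrightarrow> y \<in> carrier L \<Longrightarrow> br x y \<in> carrier L"
    and br_add_left: "x \<in> carrier L \<Longrightarrow> y \<in> carrier L \<Longrightarrow> z \<in> carrier L \<Longrightarrow>
      br (x \<oplus>\<^bsub>L\<^esub> y) z = br x z \<oplus>\<^bsub>L\<^esub> br y z"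
    and br_add_right: "x \<in> carrier L \<Longrightarrow> y \<in> carrier L \<Longrightarrow> z \<in> carrier L \<Longrightarrow>
      br x (y \<oplus>\<^bsub>L\<^esub> z) = br x y \<oplus>\<^bsub>L\<^esub> br x z"
    and br_smult_left: "c \<in> carrier K \<Longrightarrow> x \<in> carrier L \<Longrightarrow> y \<in> carrier L \<Longrightarrow>
      br (c \<odot>\<^bsub>L\<^esub> x) y = c \<odot>\<^bsub>L\<^esub> br x y"
    and br_smult_right: "c \<in> carrier K \<Longrightarrow> x \<in> carrier L \<Longrightarrow> y \<in> carrier L \<Longrightarrow>
      br x (c \<odot>\<^bsub>L\<^esub> y) = c \<odot>\<^bsub>L\<^esub> br x y"
    and br_alternating: "x \<in> carrier L \<Longrightarrow> br x x = \<zero>\<^bsub>L\<^esub>"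
    and br_jacobi: "x \<in> carrier L \<Longrightarrow> y \<in> carrier L \<Longrightarrow> z \<in> carrier L \<Longrightarrow>
      br x (br y z) \<oplus>\<^bsub>L\<^esub> br y (br z x) \<oplus>\<^bsub>L\<^esub> br z (br x y) = \<zero>\<^bsub>L\<^esub>"

definition scalar_space :: "('k, 'm) ring_scheme \<Rightarrow> ('k, 'k) module" where
  "scalar_space K = \<lparr>carrier = carrier K, mult = (\<otimes>\<^bsub>K\<^esub>), one = \<one>\<^bsub>K\<^esub>,
     zero = \<zero>\<^bsub>K\<^esub>, add = (\<oplus>\<^bsub>K\<^esub>), smult = (\<otimes>\<^bsub>K\<^esub>)\<rparr>"

definition lie_X :: "('k, 'm) ring_scheme \<Rightarrow> ('k, 'l, 'n) module_scheme \<Rightarrow> ('k, 'k \<times> 'l) module" where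
  "lie_X K L = direct_sum (scalar_space K) L"

abbreviation lie_X2 where
  "lie_X2 K L \<equiv> tensor_space K (lie_X K L) (lie_X K L)"

text \<open>The threefold tensor power of \<open>X\<close> is taken as \<open>X \<otimes> (X \<otimes> X)\<close>, the fourfold one as
  \<open>(X \<otimes> X) \<otimes> (X \<otimes> X)\<close>.\<close>

abbreviation lie_X3 where
  "lie_X3 K L \<equiv> tensor_space K (lie_X K L) (lie_X2 K L)"

abbreviation lie_X4 where
  "lie_X4 K L \<equiv> tensor_space K (lie_X2 K L) (lie_X2 K L)"

definition lie_Delta ::
  "('k, 'm) ring_scheme \<Rightarrow> ('k, 'l, 'n) module_scheme \<Rightarrow> 'k \<times> 'l
    \<Rightarrow> (('k \<times> 'l) \<times> ('k \<times> 'l) \<Rightarrow> 'k) set" where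
  "lie_Delta K L = (\<lambda>(a, x).
     tensor K (lie_X K L) (lie_X K L) (a, x) (\<one>\<^bsub>K\<^esub>, \<zero>\<^bsub>L\<^esub>)
       \<oplus>\<^bsub>lie_X2 K L\<^esub> tensor K (lie_X K L) (lie_X K L) (\<one>\<^bsub>K\<^esub>, \<zero>\<^bsub>L\<^esub>) (\<zero>\<^bsub>K\<^esub>, x))"

definition lie_Delta3 ::
  "('k, 'm) ring_scheme \<Rightarrow> ('k, 'l, 'n) module_scheme \<Rightarrow> 'k \<times> 'l
    \<Rightarrow> (('k \<times> 'l) \<times> (('k \<times> 'l) \<times> ('k \<times> 'l) \<Rightarrow> 'k) set \<Rightarrow> 'k) set" where
  "lie_Delta3 K L =
     tensor_map K (lie_X K L) (lie_X K L) (lie_X K L) (lie_X2 K L) id (lie_Delta K L)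
       \<circ> lie_Delta K L"

text \<open>The linear map on \<open>X \<otimes> (X \<otimes> X)\<close> induced by a trilinear \<open>F\<close>. Applied to
  \<open>lie_Delta3 K L z\<close> it is the Sweedler expression \<open>F z(1) z(2) z(3)\<close>, sum understood.\<close>

definition lie_lift3 ::
  "('k, 'm) ring_scheme \<Rightarrow> ('k, 'l, 'n) module_scheme \<Rightarrow> ('k, 'z, 'n2) module_scheme
    \<Rightarrow> ('k \<times> 'l \<Rightarrow> 'k \<times> 'l \<Rightarrow> 'k \<times> 'l \<Rightarrow> 'z)
    \<Rightarrow> (('k \<times> 'l) \<times> (('k \<times> 'l) \<times> ('k \<times> 'l) \<Rightarrow> 'k) set \<Rightarrow> 'k) set \<Rightarrow> 'z" where
  "lie_lift3 K L Z F =
     tensor_lift K (lie_X K L) (lie_X2 K L) Z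
       (\<lambda>u. tensor_lift K (lie_X K L) (lie_X K L) Z (F u))"

definition lie_T ::
  "('k, 'm) ring_scheme \<Rightarrow> ('k, 'l, 'n) module_scheme \<Rightarrow> ('l \<Rightarrow> 'l \<Rightarrow> 'l)
    \<Rightarrow> (('k \<times> 'l) \<times> (('k \<times> 'l) \<times> ('k \<times> 'l) \<Rightarrow> 'k) set \<Rightarrow> 'k) set \<Rightarrow> 'k \<times> 'l" where
  "lie_T K L br = lie_lift3 K L (lie_X K L) (\<lambda>(a, x) (b, y) (c, z).
     (a \<otimes>\<^bsub>K\<^esub> b \<otimes>\<^bsub>K\<^esub> c,
      (b \<otimes>\<^bsub>K\<^esub> c) \<odot>\<^bsub>L\<^esub> x \<oplus>\<^bsub>L\<^esub> c \<odot>\<^bsub>L\<^esub> br x y \<oplus>\<^bsub>L\<^esub> b \<odot>\<^bsub>L\<^esub> br x z \<oplus>\<^bsub>L\<^esub> br (br x y) z))"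

text \<open>The value of \<open>R\<close> on \<open>x \<otimes> y \<otimes> z \<otimes> w\<close> (a multilinear expression in its four arguments), and its
  linear extension.\<close>

definition lie_R_pure ::
  "('k, 'm) ring_scheme \<Rightarrow> ('k, 'l, 'n) module_scheme \<Rightarrow> ('l \<Rightarrow> 'l \<Rightarrow> 'l)
    \<Rightarrow> 'k \<times> 'l \<Rightarrow> 'k \<times> 'l \<Rightarrow> 'k \<times> 'l \<Rightarrow> 'k \<times> 'l
    \<Rightarrow> ((('k \<times> 'l) \<times> ('k \<times> 'l) \<Rightarrow> 'k) set \<times> (('k \<times> 'l) \<times> ('k \<times> 'l) \<Rightarrow> 'k) set \<Rightarrow> 'k) set" where
  "lie_R_pure K L br x y z w =
    (let X = lie_X K L;
         X2 = lie_X2 K L;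
         X4 = lie_X4 K L;
         T = (\<lambda>p q r. lie_T K L br (tensor K X X2 p (tensor K X X q r)))
     in lie_lift3 K L X4 (\<lambda>z1 z2 z3.
          lie_lift3 K L X4 (\<lambda>w1 w2 w3.
            tensor K X2 X2 (tensor K X X z1 w1) (tensor K X X (T x z2 w2) (T y z3 w3)))
          (lie_Delta3 K L w)) (lie_Delta3 K L z))"

definition lie_R ::
  "('k, 'm) ring_scheme \<Rightarrow> ('k, 'l, 'n) module_scheme \<Rightarrow> ('l \<Rightarrow> 'l \<Rightarrow> 'l)
    \<Rightarrow> ((('k \<times> 'l) \<times> ('k \<times> 'l) \<Rightarrow> 'k) set \<times> (('k \<times> 'l) \<times> ('k \<times> 'l) \<Rightarrow> 'k) set \<Rightarrow> 'k) set
    \<Rightarrow> ((('k \<times> 'l) \<times> ('k \<times> 'l) \<Rightarrow> 'k) set \<times> (('k \<times> 'l) \<times> ('k \<times> 'l) \<Rightarrow> 'k) set \<Rightarrow> 'k) set" where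
  "lie_R K L br =
    (let X = lie_X K L;
         X2 = lie_X2 K L;
         X4 = lie_X4 K L
     in tensor_lift K X2 X2 X4
          (\<lambda>s t. tensor_lift K X X X4
            (\<lambda>x y. tensor_lift K X X X4 (\<lambda>z w. lie_R_pure K L br x y z w) t) s))"

end

theory Submission
  imports Defs
begin

text \<open>
  Only the Leibniz rule matters. On \<open>X\<close> put the bracket \<open>{(a, x), (c, z)} = (0, [x, z])\<close>, for which
  \<open>e = (1, 0)\<close> is central, and let \<open>z \<in> X\<close> act on \<open>V = X \<otimes> X\<close> by the derivation \<open>D z\<close> induced by
  \<open>{\<cdot>, z}\<close>. Since \<open>\<Delta> z = z \<otimes> e + e \<otimes> z'\<close> with \<open>z'\<close> the Lie part of \<open>z\<close>, unfolding the Sweedler sums gives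
  \<open>R (s \<otimes> (z \<otimes> w)) = (z \<otimes> w) \<otimes> s + (z \<otimes> e) \<otimes> D w s + (e \<otimes> w) \<otimes> D z s + (e \<otimes> e) \<otimes> D w (D z s)\<close>.
  The inverse has the same shape, with the signs of the two middle terms and the order of \<open>D w\<close>, \<open>D z\<close>
  reversed. The same formula defines \<open>R\<^sub>S : S \<otimes> V \<rightarrow> V \<otimes> S\<close> for every \<open>S\<close> on which \<open>X\<close> acts; for \<open>S = V \<otimes> V\<close>
  with the diagonal action it is the composite of \<open>1 \<otimes> R\<close> and \<open>R \<otimes> 1\<close>. By the Leibniz rule \<open>R\<close> commutes
  with the diagonal action, so it slides through \<open>R\<^sub>S\<close>, which is the Yang-Baxter equation.\<close>

section \<open>Module homomorphisms and bilinear maps\<close>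

lemma module_homI:
  assumes "\<And>x. x \<in> carrier M \<Longrightarrow> f x \<in> carrier N"
    and "\<And>x y. x \<in> carrier M \<Longrightarrow> y \<in> carrier M \<Longrightarrow> f (x \<oplus>\<^bsub>M\<^esub> y) = f x \<oplus>\<^bsub>N\<^esub> f y"
    and "\<And>c x. c \<in> carrier K \<Longrightarrow> x \<in> carrier M \<Longrightarrow> f (c \<odot>\<^bsub>M\<^esub> x) = c \<odot>\<^bsub>N\<^esub> f x"
  shows "f \<in> module_hom K M N"
  using assms by (auto simp: module_hom_def)

lemma module_hom_in [intro]:
  "f \<in> module_hom K M N \<Longrightarrow> x \<in> carrier M \<Longrightarrow> f x \<in> carrier N"
  by (auto simp: module_hom_def)

text \<open>Many maps below are described only by their values on a carrier. Linearity transfers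
  along such a description because the carrier of the module \<open>M\<close> is closed under sums
  and scalar multiples.\<close>

lemma module_hom_cong:
  assumes f: "f \<in> module_hom K M N" and M: "module K M"
    and eq: "\<And>x. x \<in> carrier M \<Longrightarrow> g x = f x"
  shows "g \<in> module_hom K M N"
proof -
  interpret module K M by fact
  show ?thesis using f by (intro module_homI) (auto simp: eq module_hom_add module_hom_smult)
qed

lemma module_hom_zero:
  assumes "module K M" "module K N" "f \<in> module_hom K M N"
  shows "f \<zero>\<^bsub>M\<^esub> = \<zero>\<^bsub>N\<^esub>"
proof -
  interpret mod_hom K M N f using assms by (simp add: mod_hom_def mod_hom_axioms_def)
  show ?thesis by (rule f0_is_0)
qed

lemma module_hom_a_inv:
  assumes "module K M" "module K N" "f \<in> module_hom K M N" "x \<in> carrier M"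
  shows "f (\<ominus>\<^bsub>M\<^esub> x) = \<ominus>\<^bsub>N\<^esub> f x"
proof -
  interpret mod_hom K M N f using assms by (simp add: mod_hom_def mod_hom_axioms_def)
  show ?thesis by (rule f_neg) fact
qed

lemma module_hom_id: "module K M \<Longrightarrow> (\<lambda>x. x) \<in> module_hom K M M"
  by (auto simp: module_hom_def)

lemma module_hom_comp:
  "g \<in> module_hom K N P \<Longrightarrow> f \<in> module_hom K M N \<Longrightarrow> (\<lambda>x. g (f x)) \<in> module_hom K M P"
  by (intro module_homI) (simp_all add: module_hom_in module_hom_add module_hom_smult)

lemma module_hom_const_zero:
  assumes "module K N"
  shows "(\<lambda>_. \<zero>\<^bsub>N\<^esub>) \<in> module_hom K M N"
proof -
  interpret module K N by fact
  show ?thesis by (auto simp: module_hom_def)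
qed

lemma module_hom_plus:
  assumes N: "module K N" and f: "f \<in> module_hom K M N" and g: "g \<in> module_hom K M N"
  shows "(\<lambda>x. f x \<oplus>\<^bsub>N\<^esub> g x) \<in> module_hom K M N"
proof -
  interpret module K N by fact
  show ?thesis
    using f g
    by (intro module_homI)
      (auto simp: module_hom_add module_hom_smult smult_r_distr module_hom_in M.a_ac)
qed

lemma module_hom_uminus:
  assumes N: "module K N" and f: "f \<in> module_hom K M N"
  shows "(\<lambda>x. \<ominus>\<^bsub>N\<^esub> f x) \<in> module_hom K M N"
proof -
  interpret module K N by fact
  show ?thesis
    using f
    by (intro module_homI)
      (auto simp: module_hom_add module_hom_smult smult_r_minus module_hom_in M.minus_add)
qed

section \<open>Bilinear maps\<close>

text \<open>Phrased through \<open>module_hom\<close> in each argument, so that the closure rules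
  for homomorphisms carry over one argument at a time.\<close>

definition bilinear_map ::
  "('k, 'm) ring_scheme \<Rightarrow> ('k, 'v, 'n1) module_scheme \<Rightarrow> ('k, 'w, 'n2) module_scheme
    \<Rightarrow> ('k, 'z, 'n3) module_scheme \<Rightarrow> ('v \<Rightarrow> 'w \<Rightarrow> 'z) \<Rightarrow> bool" where
  "bilinear_map K V W Z B \<longleftrightarrow>
     (\<forall>v\<in>carrier V. B v \<in> module_hom K W Z) \<and>
     (\<forall>w\<in>carrier W. (\<lambda>v. B v w) \<in> module_hom K V Z)"

lemma bilinear_mapI:
  assumes "\<And>v. v \<in> carrier V \<Longrightarrow> (\<lambda>w. B v w) \<in> module_hom K W Z"
    and "\<And>w. w \<in> carrier W \<Longrightarrow> (\<lambda>v. B v w) \<in> module_hom K V Z"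
  shows "bilinear_map K V W Z B"
  using assms by (simp add: bilinear_map_def)

lemma bilinear_map_right: "bilinear_map K V W Z B \<Longrightarrow> v \<in> carrier V \<Longrightarrow> B v \<in> module_hom K W Z"
  by (simp add: bilinear_map_def)

lemma bilinear_map_left:
  "bilinear_map K V W Z B \<Longrightarrow> w \<in> carrier W \<Longrightarrow> (\<lambda>v. B v w) \<in> module_hom K V Z"
  by (simp add: bilinear_map_def)

lemma bilinear_map_in:
  "bilinear_map K V W Z B \<Longrightarrow> v \<in> carrier V \<Longrightarrow> w \<in> carrier W \<Longrightarrow> B v w \<in> carrier Z"
  by (auto simp: bilinear_map_def)

section \<open>Free modules\<close>

lemma carrier_free_space:
  assumes "cring K"
  shows "f \<in> carrier (free_space K S) \<longleftrightarrow>
    f \<in> S \<rightarrow>\<^sub>E carrier K \<and> finite {s \<in> S. f s \<noteq> \<zero>\<^bsub>K\<^esub>}"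
proof -
  interpret cring K by fact
  show ?thesis by (simp add: free_space_def func_space_def)
qed

lemma free_space_sel:
  assumes "cring K"
  shows "\<zero>\<^bsub>free_space K S\<^esub> = (\<lambda>s\<in>S. \<zero>\<^bsub>K\<^esub>)"
    and "f \<oplus>\<^bsub>free_space K S\<^esub> g = (\<lambda>s\<in>S. f s \<oplus>\<^bsub>K\<^esub> g s)"
    and "c \<odot>\<^bsub>free_space K S\<^esub> f = (\<lambda>s\<in>S. c \<otimes>\<^bsub>K\<^esub> f s)"
proof -
  interpret cring K by fact
  show "\<zero>\<^bsub>free_space K S\<^esub> = (\<lambda>s\<in>S. \<zero>\<^bsub>K\<^esub>)"
    and "f \<oplus>\<^bsub>free_space K S\<^esub> g = (\<lambda>s\<in>S. f s \<oplus>\<^bsub>K\<^esub> g s)"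
    and "c \<odot>\<^bsub>free_space K S\<^esub> f = (\<lambda>s\<in>S. c \<otimes>\<^bsub>K\<^esub> f s)"
    by (simp_all add: free_space_def func_space_def)
qed

text \<open>The finitely supported functions form a submodule of all functions: the support of a sum
  lies in the union of the supports, and scaling does not enlarge a support.\<close>

lemma free_space_module:
  assumes "cring K"
  shows "module K (free_space K S)"
proof -
  interpret cring K by fact
  interpret F: module K "func_space S" by (rule func_space_is_module)
  let ?N = "{f \<in> carrier (func_space S). finite {s \<in> S. f s \<noteq> \<zero>\<^bsub>K\<^esub>}}"
  have "submodule K ?N (func_space S)"
  proof (unfold_locales)
    show "?N \<subseteq> carrier (func_space S)" by auto
    show "\<zero>\<^bsub>func_space S\<^esub> \<in> ?N" by (auto simp: func_space_def)
    show "v \<oplus>\<^bsub>func_space S\<^esub> w \<in> ?N" if v: "v \<in> ?N" and w: "w \<in> ?N" for v w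
    proof -
      have "{s \<in> S. (v \<oplus>\<^bsub>func_space S\<^esub> w) s \<noteq> \<zero>\<^bsub>K\<^esub>}
          \<subseteq> {s \<in> S. v s \<noteq> \<zero>\<^bsub>K\<^esub>} \<union> {s \<in> S. w s \<noteq> \<zero>\<^bsub>K\<^esub>}"
        by (auto simp: func_space_def)
      then show ?thesis using v w by (auto intro: finite_subset)
    qed
    show "c \<odot>\<^bsub>func_space S\<^esub> v \<in> ?N" if c: "c \<in> carrier K" and v: "v \<in> ?N" for c v
    proof -
      have "{s \<in> S. (c \<odot>\<^bsub>func_space S\<^esub> v) s \<noteq> \<zero>\<^bsub>K\<^esub>} \<subseteq> {s \<in> S. v s \<noteq> \<zero>\<^bsub>K\<^esub>}"
        using c by (auto simp: func_space_def)
      then show ?thesis using c v by (auto intro: finite_subset)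
    qed
  qed
  then show ?thesis unfolding free_space_def by (rule F.submodule_is_module)
qed

lemma free_gen_in:
  assumes "cring K" "s \<in> S"
  shows "free_gen K S s \<in> carrier (free_space K S)"
proof -
  interpret cring K by fact
  have "{t \<in> S. free_gen K S s t \<noteq> \<zero>\<^bsub>K\<^esub>} \<subseteq> {s}"
    by (auto simp: free_gen_def split: if_splits)
  then show ?thesis
    unfolding carrier_free_space[OF \<open>cring K\<close>] by (auto simp: free_gen_def intro: finite_subset)
qed

lemma free_space_induct [consumes 2, case_names zero add]:
  assumes K: "cring K" and f: "f \<in> carrier (free_space K S)"
    and zero: "P \<zero>\<^bsub>free_space K S\<^esub>"
    and add: "\<And>c s f. c \<in> carrier K \<Longrightarrow> s \<in> S \<Longrightarrow> f \<in> carrier (free_space K S) \<Longrightarrow> P f \<Longrightarrow>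
      P ((c \<odot>\<^bsub>free_space K S\<^esub> free_gen K S s) \<oplus>\<^bsub>free_space K S\<^esub> f)"
  shows "P f"
proof -
  interpret cring K by fact
  \<comment> \<open>The induction runs over a finite set \<open>A\<close> that contains the support,
    so the value at the point removed from \<open>A\<close> may also be zero.\<close>
  have "P f" if "finite A" "{s \<in> S. f s \<noteq> \<zero>\<^bsub>K\<^esub>} \<subseteq> A" "A \<subseteq> S"
      "f \<in> carrier (free_space K S)" for A f
    using that
  proof (induction A arbitrary: f rule: finite_induct)
    case empty
    then have "f = \<zero>\<^bsub>free_space K S\<^esub>"
      unfolding carrier_free_space[OF K] free_space_sel[OF K] by (auto simp: PiE_def extensional_def)
    then show ?case using zero by simp
  next
    case (insert a A)
    \<comment> \<open>Erasing the value at \<open>a\<close> leaves a support inside the smaller set;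
      adding \<open>f a\<close> times the generator at \<open>a\<close> restores
      \<open>f\<close>.\<close>
    let ?g = "f(a := \<zero>\<^bsub>K\<^esub>)"
    have fa: "f \<in> S \<rightarrow>\<^sub>E carrier K" "a \<in> S"
      using insert.prems unfolding carrier_free_space[OF K] by auto
    have sub: "{s \<in> S. ?g s \<noteq> \<zero>\<^bsub>K\<^esub>} \<subseteq> A" using insert.prems by auto
    have g: "?g \<in> carrier (free_space K S)"
      unfolding carrier_free_space[OF K]
      using fa finite_subset[OF sub \<open>finite A\<close>] by (auto simp: PiE_def extensional_def)
    have "P ?g" using insert.IH[OF sub _ g] insert.prems by (auto simp: fun_upd_def)
    moreover have "f a \<in> carrier K" using fa by auto
    ultimately have
      "P ((f a \<odot>\<^bsub>free_space K S\<^esub> free_gen K S a) \<oplus>\<^bsub>free_space K S\<^esub> ?g)"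
      using g fa by (intro add)
    moreover have "(f a \<odot>\<^bsub>free_space K S\<^esub> free_gen K S a) \<oplus>\<^bsub>free_space K S\<^esub> ?g = f"
      unfolding free_space_sel[OF K]
    proof
      fix s
      show "(\<lambda>s\<in>S. (\<lambda>t\<in>S. f a \<otimes>\<^bsub>K\<^esub> free_gen K S a t) s \<oplus>\<^bsub>K\<^esub> ?g s) s = f s"
        using fa by (cases "s \<in> S") (auto simp: free_gen_def PiE_def extensional_def Pi_iff)
    qed
    ultimately show ?case by simp
  qed
  then show ?thesis using f unfolding carrier_free_space[OF K] by blast
qed

section \<open>Linear extension from a free module\<close>

text \<open>The sum that occurs in \<open>tensor_lift\<close>, for an arbitrary index set: the
  linear extension of \<open>b\<close> from generators to finitely supported functions.\<close>

definition free_lift ::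
  "('k, 'm) ring_scheme \<Rightarrow> 's set \<Rightarrow> ('k, 'z, 'n) module_scheme \<Rightarrow> ('s \<Rightarrow> 'z) \<Rightarrow> ('s \<Rightarrow> 'k) \<Rightarrow> 'z" where
  "free_lift K S Z b f = (\<Oplus>\<^bsub>Z\<^esub>p\<in>{p \<in> S. f p \<noteq> \<zero>\<^bsub>K\<^esub>}. f p \<odot>\<^bsub>Z\<^esub> b p)"

text \<open>Terms outside the support vanish. Enlarging the index set makes sums for functions with
  different supports comparable.\<close>

lemma free_lift_superset:
  assumes Z: "module K Z" and b: "b \<in> S \<rightarrow> carrier Z" and f: "f \<in> S \<rightarrow> carrier K"
    and A: "finite A" "{p \<in> S. f p \<noteq> \<zero>\<^bsub>K\<^esub>} \<subseteq> A" "A \<subseteq> S"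
  shows "free_lift K S Z b f = (\<Oplus>\<^bsub>Z\<^esub>p\<in>A. f p \<odot>\<^bsub>Z\<^esub> b p)"
proof -
  interpret module K Z by fact
  show ?thesis
    unfolding free_lift_def
    by (rule M.add.finprod_mono_neutral_cong_left) (use A b f in \<open>auto simp: Pi_iff\<close>)
qed

lemma free_lift_hom:
  assumes Z: "module K Z" and b: "b \<in> S \<rightarrow> carrier Z"
  shows "free_lift K S Z b \<in> module_hom K (free_space K S) Z"
proof -
  interpret module K Z by fact
  have K: "cring K" ..
  show ?thesis
  proof (rule module_homI)
    fix f g assume fg: "f \<in> carrier (free_space K S)" "g \<in> carrier (free_space K S)"
    \<comment> \<open>A common finite index set for the three sums, since it also contains the
      support of the sum of \<open>f\<close> and \<open>g\<close>.\<close>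
    let ?A = "{p \<in> S. f p \<noteq> \<zero>\<^bsub>K\<^esub>} \<union> {p \<in> S. g p \<noteq> \<zero>\<^bsub>K\<^esub>}"
    from fg have fg': "f \<in> S \<rightarrow> carrier K" "g \<in> S \<rightarrow> carrier K" and fin: "finite ?A"
      unfolding carrier_free_space[OF K] by auto
    have "free_lift K S Z b (f \<oplus>\<^bsub>free_space K S\<^esub> g)
        = (\<Oplus>\<^bsub>Z\<^esub>p\<in>?A. (f \<oplus>\<^bsub>free_space K S\<^esub> g) p \<odot>\<^bsub>Z\<^esub> b p)"
      using fg' fin by (intro free_lift_superset[OF Z b]) (auto simp: free_space_sel[OF K])
    also have "\<dots> = (\<Oplus>\<^bsub>Z\<^esub>p\<in>?A. f p \<odot>\<^bsub>Z\<^esub> b p \<oplus>\<^bsub>Z\<^esub> g p \<odot>\<^bsub>Z\<^esub> b p)"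
      using fg' b
      by (intro M.finsum_cong') (auto simp: free_space_sel[OF K] smult_l_distr Pi_iff)
    also have "\<dots> = (\<Oplus>\<^bsub>Z\<^esub>p\<in>?A. f p \<odot>\<^bsub>Z\<^esub> b p) \<oplus>\<^bsub>Z\<^esub> (\<Oplus>\<^bsub>Z\<^esub>p\<in>?A. g p \<odot>\<^bsub>Z\<^esub> b p)"
      using fg' b by (intro M.finsum_addf) (auto simp: Pi_iff)
    also have "(\<Oplus>\<^bsub>Z\<^esub>p\<in>?A. f p \<odot>\<^bsub>Z\<^esub> b p) = free_lift K S Z b f"
      using fg' fin by (intro free_lift_superset[OF Z b, symmetric]) auto
    also have "(\<Oplus>\<^bsub>Z\<^esub>p\<in>?A. g p \<odot>\<^bsub>Z\<^esub> b p) = free_lift K S Z b g"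
      using fg' fin by (intro free_lift_superset[OF Z b, symmetric]) auto
    finally show "free_lift K S Z b (f \<oplus>\<^bsub>free_space K S\<^esub> g)
        = free_lift K S Z b f \<oplus>\<^bsub>Z\<^esub> free_lift K S Z b g" .
  next
    fix c f assume c: "c \<in> carrier K" and f: "f \<in> carrier (free_space K S)"
    \<comment> \<open>The support of \<open>f\<close> contains that of its multiple by
      \<open>c\<close>, possibly properly, so it serves as index set for both sums.\<close>
    let ?A = "{p \<in> S. f p \<noteq> \<zero>\<^bsub>K\<^esub>}"
    from f have f': "f \<in> S \<rightarrow> carrier K" and fin: "finite ?A"
      unfolding carrier_free_space[OF K] by auto
    have "free_lift K S Z b (c \<odot>\<^bsub>free_space K S\<^esub> f)
        = (\<Oplus>\<^bsub>Z\<^esub>p\<in>?A. (c \<odot>\<^bsub>free_space K S\<^esub> f) p \<odot>\<^bsub>Z\<^esub> b p)"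
      using c f' fin by (intro free_lift_superset[OF Z b]) (auto simp: free_space_sel[OF K])
    also have "\<dots> = (\<Oplus>\<^bsub>Z\<^esub>p\<in>?A. c \<odot>\<^bsub>Z\<^esub> (f p \<odot>\<^bsub>Z\<^esub> b p))"
      using c f' b
      by (intro M.finsum_cong') (auto simp: free_space_sel[OF K] smult_assoc1 Pi_iff)
    also have "\<dots> = c \<odot>\<^bsub>Z\<^esub> free_lift K S Z b f"
      unfolding free_lift_def using c f' b fin
      by (intro finsum_smult[symmetric]) (auto simp: Pi_iff)
    finally show "free_lift K S Z b (c \<odot>\<^bsub>free_space K S\<^esub> f) = c \<odot>\<^bsub>Z\<^esub> free_lift K S Z b f" .
  next
    fix f assume "f \<in> carrier (free_space K S)"
    then show "free_lift K S Z b f \<in> carrier Z"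
      unfolding free_lift_def carrier_free_space[OF K] using b
      by (intro M.finsum_closed) (auto simp: Pi_iff)
  qed
qed

lemma free_lift_gen:
  assumes Z: "module K Z" and b: "b \<in> S \<rightarrow> carrier Z" and s: "s \<in> S"
  shows "free_lift K S Z b (free_gen K S s) = b s"
proof -
  interpret module K Z by fact
  have "free_lift K S Z b (free_gen K S s) = (\<Oplus>\<^bsub>Z\<^esub>p\<in>{s}. free_gen K S s p \<odot>\<^bsub>Z\<^esub> b p)"
    using s by (intro free_lift_superset[OF Z b]) (auto simp: free_gen_def split: if_splits)
  also have "\<dots> = b s" using s b by (auto simp: free_gen_def Pi_iff)
  finally show ?thesis .
qed

section \<open>Quotient modules\<close>

text \<open>Negatives stay in \<open>N\<close> because they are multiples by minus one. This gives
  access to the theory of additive cosets.\<close>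

lemma submodule_abelian_subgroup:
  assumes "submodule K N M"
  shows "abelian_subgroup N M"
proof -
  interpret sub: submodule K N M by fact
  interpret module K M by (rule sub.module)
  have "subgroup N (add_monoid M)"
  proof (rule M.add.subgroupI)
    show "N \<noteq> {}" using sub.zero_closed by blast
    show "\<ominus>\<^bsub>M\<^esub> a \<in> N" if "a \<in> N" for a
      using that sub.subset sub.smult_closed[of "\<ominus>\<^bsub>K\<^esub> \<one>\<^bsub>K\<^esub>" a] smult_minus_1[of a]
      by (auto simp: subset_iff)
  qed (use sub.subset in auto)
  then show ?thesis
    by (intro abelian_subgroupI3 additive_subgroupI M.abelian_group_axioms)
qed

lemma quotient_space_simps:
  assumes "submodule K N M"
  shows "carrier (quotient_space M N) = (\<lambda>x. N +>\<^bsub>M\<^esub> x) ` carrier M"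
    and "\<zero>\<^bsub>quotient_space M N\<^esub> = N +>\<^bsub>M\<^esub> \<zero>\<^bsub>M\<^esub>"
    and "\<lbrakk>x \<in> carrier M; y \<in> carrier M\<rbrakk> \<Longrightarrow>
      (N +>\<^bsub>M\<^esub> x) \<oplus>\<^bsub>quotient_space M N\<^esub> (N +>\<^bsub>M\<^esub> y) = N +>\<^bsub>M\<^esub> (x \<oplus>\<^bsub>M\<^esub> y)"
    and "\<lbrakk>c \<in> carrier K; x \<in> carrier M\<rbrakk> \<Longrightarrow>
      c \<odot>\<^bsub>quotient_space M N\<^esub> (N +>\<^bsub>M\<^esub> x) = N +>\<^bsub>M\<^esub> (c \<odot>\<^bsub>M\<^esub> x)"
proof -
  interpret submodule K N M by fact
  interpret module K M by (rule module)
  interpret S: abelian_subgroup N M by (rule submodule_abelian_subgroup) fact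
  show "carrier (quotient_space M N) = (\<lambda>x. N +>\<^bsub>M\<^esub> x) ` carrier M"
    by (auto simp: quotient_space_def A_RCOSETS_def')
  show "\<zero>\<^bsub>quotient_space M N\<^esub> = N +>\<^bsub>M\<^esub> \<zero>\<^bsub>M\<^esub>"
    using subset by (simp add: quotient_space_def)
  show "(N +>\<^bsub>M\<^esub> x) \<oplus>\<^bsub>quotient_space M N\<^esub> (N +>\<^bsub>M\<^esub> y) = N +>\<^bsub>M\<^esub> (x \<oplus>\<^bsub>M\<^esub> y)"
    if "x \<in> carrier M" "y \<in> carrier M"
    using that by (simp add: quotient_space_def S.a_rcos_sum)
  show "c \<odot>\<^bsub>quotient_space M N\<^esub> (N +>\<^bsub>M\<^esub> x) = N +>\<^bsub>M\<^esub> (c \<odot>\<^bsub>M\<^esub> x)"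
    if c: "c \<in> carrier K" and x: "x \<in> carrier M"
  proof -
    \<comment> \<open>All representatives \<open>v\<close> of the coset of \<open>x\<close>
      contribute the same coset, as \<open>c\<close> maps the difference \<open>n\<close> into
      \<open>N\<close>. Hence the union that defines scalar multiplication collapses to one
      coset.\<close>
    have "N +>\<^bsub>M\<^esub> (c \<odot>\<^bsub>M\<^esub> v) = N +>\<^bsub>M\<^esub> (c \<odot>\<^bsub>M\<^esub> x)" if v: "v \<in> N +>\<^bsub>M\<^esub> x" for v
    proof -
      from v obtain n where n: "n \<in> N" "v = n \<oplus>\<^bsub>M\<^esub> x" by (auto simp: a_r_coset_def')
      then have "c \<odot>\<^bsub>M\<^esub> v = (c \<odot>\<^bsub>M\<^esub> n) \<oplus>\<^bsub>M\<^esub> (c \<odot>\<^bsub>M\<^esub> x)"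
        using c x subset by (auto simp: smult_r_distr)
      then have "c \<odot>\<^bsub>M\<^esub> v \<in> N +>\<^bsub>M\<^esub> (c \<odot>\<^bsub>M\<^esub> x)"
        using n c by (auto simp: a_r_coset_def')
      then show ?thesis
        using c x by (intro M.a_repr_independence[symmetric] S.a_subgroup) auto
    qed
    moreover have "x \<in> N +>\<^bsub>M\<^esub> x" using x by (rule S.a_rcos_self)
    ultimately have "(\<Union>v\<in>N +>\<^bsub>M\<^esub> x. N +>\<^bsub>M\<^esub> (c \<odot>\<^bsub>M\<^esub> v)) = N +>\<^bsub>M\<^esub> (c \<odot>\<^bsub>M\<^esub> x)"
      by blast
    then show ?thesis by (simp add: quotient_space_def)
  qed
qed

lemma quotient_space_module:
  assumes N: "submodule K N M"
  shows "module K (quotient_space M N)"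
proof -
  interpret submodule K N M by fact
  interpret module K M by (rule module)
  note Q = quotient_space_simps[OF N]
  have neg: "\<exists>w\<in>carrier M. (N +>\<^bsub>M\<^esub> v) \<oplus>\<^bsub>quotient_space M N\<^esub> (N +>\<^bsub>M\<^esub> w) = N +>\<^bsub>M\<^esub> \<zero>\<^bsub>M\<^esub>"
    if "v \<in> carrier M" for v
    using that by (intro bexI[of _ "\<ominus>\<^bsub>M\<^esub> v"]) (auto simp: Q M.r_neg)
  have K: "cring K" ..
  show ?thesis
  proof (rule module_criteria[OF K]; (intro allI impI ballI; (elim conjE)?)?)
    fix v assume "v \<in> carrier (quotient_space M N)"
    then obtain x where "x \<in> carrier M" "v = N +>\<^bsub>M\<^esub> x" by (auto simp: Q(1))
    with neg[of x] show "\<exists>w\<in>carrier (quotient_space M N).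
        v \<oplus>\<^bsub>quotient_space M N\<^esub> w = \<zero>\<^bsub>quotient_space M N\<^esub>"
      by (auto simp: Q(1,2))
  qed (auto simp: Q M.a_ac smult_l_distr smult_r_distr smult_assoc1)
qed

section \<open>Tensor products\<close>

lemma tensor_relations_subset:
  assumes V: "module K V" and W: "module K W"
  shows "tensor_relations K V W \<subseteq> carrier (free_space K (carrier V \<times> carrier W))"
proof -
  interpret V: module K V by fact
  interpret W: module K W by fact
  have K: "cring K" ..
  interpret F: module K "free_space K (carrier V \<times> carrier W)" by (rule free_space_module[OF K])
  show ?thesis
    unfolding tensor_relations_def Let_def by (auto intro!: free_gen_in[OF K])
qed

lemma tensor_relationsI:
  fixes K V W
  defines "F \<equiv> free_space K (carrier V \<times> carrier W)"
    and "g \<equiv> free_gen K (carrier V \<times> carrier W)"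
  shows "\<lbrakk>v \<in> carrier V; v' \<in> carrier V; w \<in> carrier W\<rbrakk> \<Longrightarrow>
      g (v \<oplus>\<^bsub>V\<^esub> v', w) \<ominus>\<^bsub>F\<^esub> (g (v, w) \<oplus>\<^bsub>F\<^esub> g (v', w)) \<in> tensor_relations K V W"
    and "\<lbrakk>v \<in> carrier V; w \<in> carrier W; w' \<in> carrier W\<rbrakk> \<Longrightarrow>
      g (v, w \<oplus>\<^bsub>W\<^esub> w') \<ominus>\<^bsub>F\<^esub> (g (v, w) \<oplus>\<^bsub>F\<^esub> g (v, w')) \<in> tensor_relations K V W"
    and "\<lbrakk>c \<in> carrier K; v \<in> carrier V; w \<in> carrier W\<rbrakk> \<Longrightarrow>
      g (c \<odot>\<^bsub>V\<^esub> v, w) \<ominus>\<^bsub>F\<^esub> (c \<odot>\<^bsub>F\<^esub> g (v, w)) \<in> tensor_relations K V W"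
    and "\<lbrakk>c \<in> carrier K; v \<in> carrier V; w \<in> carrier W\<rbrakk> \<Longrightarrow>
      g (v, c \<odot>\<^bsub>W\<^esub> w) \<ominus>\<^bsub>F\<^esub> (c \<odot>\<^bsub>F\<^esub> g (v, w)) \<in> tensor_relations K V W"
  unfolding tensor_relations_def Let_def F_def g_def Un_iff mem_Collect_eq by blast+

lemma tensor_null_submodule:
  assumes V: "module K V" and W: "module K W"
  shows "submodule K (tensor_null K V W) (free_space K (carrier V \<times> carrier W))"
proof -
  interpret V: module K V by fact
  have K: "cring K" ..
  interpret F: module K "free_space K (carrier V \<times> carrier W)" by (rule free_space_module[OF K])
  show ?thesis
    unfolding tensor_null_def by (rule F.span_is_submodule) (rule tensor_relations_subset[OF V W])
qed

lemma tensor_space_module [simp]: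
  assumes V: "module K V" and W: "module K W"
  shows "module K (tensor_space K V W)"
  unfolding tensor_space_def by (intro quotient_space_module tensor_null_submodule V W)

text \<open>A defining relation lies in the span that is factored out, so its two sides become equal
  in the quotient. Each family of relations thereby yields one of the bilinearity laws of
  \<open>tensor\<close>.\<close>

lemma coset_eqI_tensor_relations:
  assumes V: "module K V" and W: "module K W"
    and "x \<in> carrier (free_space K (carrier V \<times> carrier W))"
    and "y \<in> carrier (free_space K (carrier V \<times> carrier W))"
    and rel: "x \<ominus>\<^bsub>free_space K (carrier V \<times> carrier W)\<^esub> y \<in> tensor_relations K V W"
  shows "tensor_null K V W +>\<^bsub>free_space K (carrier V \<times> carrier W)\<^esub> x
    = tensor_null K V W +>\<^bsub>free_space K (carrier V \<times> carrier W)\<^esub> y"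
proof -
  interpret V: module K V by fact
  have K: "cring K" ..
  let ?F = "free_space K (carrier V \<times> carrier W)"
  interpret F: module K ?F by (rule free_space_module[OF K])
  interpret N: abelian_subgroup "tensor_null K V W" ?F
    by (rule submodule_abelian_subgroup[OF tensor_null_submodule[OF V W]])
  have "x \<ominus>\<^bsub>?F\<^esub> y \<in> tensor_null K V W"
    using F.in_own_span[OF tensor_relations_subset[OF V W]] rel unfolding tensor_null_def by blast
  moreover have "x = (x \<ominus>\<^bsub>?F\<^esub> y) \<oplus>\<^bsub>?F\<^esub> y"
    using assms(3,4) by (simp add: a_minus_def F.M.a_assoc F.M.l_neg)
  ultimately have "x \<in> tensor_null K V W +>\<^bsub>?F\<^esub> y" unfolding a_r_coset_def' by blast
  then show ?thesis using assms(4) by (intro F.M.a_repr_independence[symmetric] N.a_subgroup) auto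
qed

lemma tensor_bilinear:
  assumes V: "module K V" and W: "module K W"
  shows "bilinear_map K V W (tensor_space K V W) (tensor K V W)"
proof -
  interpret V: module K V by fact
  interpret W: module K W by fact
  have K: "cring K" ..
  let ?S = "carrier V \<times> carrier W"
  let ?F = "free_space K ?S"
  interpret F: module K ?F by (rule free_space_module[OF K])
  note Q = quotient_space_simps[OF tensor_null_submodule[OF V W], folded tensor_space_def]
  have g: "free_gen K ?S (v, w) \<in> carrier ?F" if "v \<in> carrier V" "w \<in> carrier W" for v w
    using that by (intro free_gen_in[OF K]) auto
  note eqI = coset_eqI_tensor_relations[OF V W]
  show ?thesis
  proof (intro bilinear_mapI module_homI)
    fix v w assume "v \<in> carrier V" "w \<in> carrier W"
    then show "tensor K V W v w \<in> carrier (tensor_space K V W)"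
      and "tensor K V W v w \<in> carrier (tensor_space K V W)"
      using g by (auto simp: tensor_def Q(1))
  next
    fix v w w' assume m: "v \<in> carrier V" "w \<in> carrier W" "w' \<in> carrier W"
    have "tensor K V W v (w \<oplus>\<^bsub>W\<^esub> w') = tensor_null K V W +>\<^bsub>?F\<^esub>
        (free_gen K ?S (v, w) \<oplus>\<^bsub>?F\<^esub> free_gen K ?S (v, w'))"
      unfolding tensor_def using m
      by (intro eqI g F.M.a_closed tensor_relationsI) auto
    then show "tensor K V W v (w \<oplus>\<^bsub>W\<^esub> w')
        = tensor K V W v w \<oplus>\<^bsub>tensor_space K V W\<^esub> tensor K V W v w'"
      unfolding tensor_def using m by (simp add: Q(3) g)
  next
    fix v v' w assume m: "v \<in> carrier V" "v' \<in> carrier V" "w \<in> carrier W"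
    have "tensor K V W (v \<oplus>\<^bsub>V\<^esub> v') w = tensor_null K V W +>\<^bsub>?F\<^esub>
        (free_gen K ?S (v, w) \<oplus>\<^bsub>?F\<^esub> free_gen K ?S (v', w))"
      unfolding tensor_def using m
      by (intro eqI g F.M.a_closed tensor_relationsI) auto
    then show "tensor K V W (v \<oplus>\<^bsub>V\<^esub> v') w
        = tensor K V W v w \<oplus>\<^bsub>tensor_space K V W\<^esub> tensor K V W v' w"
      unfolding tensor_def using m by (simp add: Q(3) g)
  next
    fix c v w assume m: "c \<in> carrier K" "v \<in> carrier V" "w \<in> carrier W"
    have "tensor K V W v (c \<odot>\<^bsub>W\<^esub> w) = tensor_null K V W +>\<^bsub>?F\<^esub>
        (c \<odot>\<^bsub>?F\<^esub> free_gen K ?S (v, w))"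
      unfolding tensor_def using m
      by (intro eqI g F.smult_closed tensor_relationsI) auto
    then show "tensor K V W v (c \<odot>\<^bsub>W\<^esub> w) = c \<odot>\<^bsub>tensor_space K V W\<^esub> tensor K V W v w"
      unfolding tensor_def using m by (simp add: Q(4) g)
    have "tensor K V W (c \<odot>\<^bsub>V\<^esub> v) w = tensor_null K V W +>\<^bsub>?F\<^esub>
        (c \<odot>\<^bsub>?F\<^esub> free_gen K ?S (v, w))"
      unfolding tensor_def using m
      by (intro eqI g F.smult_closed tensor_relationsI) auto
    then show "tensor K V W (c \<odot>\<^bsub>V\<^esub> v) w = c \<odot>\<^bsub>tensor_space K V W\<^esub> tensor K V W v w"
      unfolding tensor_def using m by (simp add: Q(4) g)
  qed
qed

lemma tensor_in [simp, intro]: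
  assumes "module K V" "module K W" "v \<in> carrier V" "w \<in> carrier W"
  shows "tensor K V W v w \<in> carrier (tensor_space K V W)"
  by (rule bilinear_map_in[OF tensor_bilinear]) (rule assms)+

lemmas tensor_hom_right = bilinear_map_right[OF tensor_bilinear]
lemmas tensor_hom_left = bilinear_map_left[OF tensor_bilinear]

section \<open>The universal property of the tensor product\<close>

text \<open>Every element is a sum of pure tensors: zero is the pure tensor of two zeros, and the
  scalar in front of a generator is absorbed into the left factor.\<close>

lemma tensor_induct [consumes 3, case_names tensor add]:
  assumes V: "module K V" and W: "module K W" and t: "t \<in> carrier (tensor_space K V W)"
    and tensor: "\<And>v w. v \<in> carrier V \<Longrightarrow> w \<in> carrier W \<Longrightarrow> P (tensor K V W v w)"
    and add: "\<And>s t. s \<in> carrier (tensor_space K V W) \<Longrightarrow> t \<in> carrier (tensor_space K V W) \<Longrightarrow>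
      P s \<Longrightarrow> P t \<Longrightarrow> P (s \<oplus>\<^bsub>tensor_space K V W\<^esub> t)"
  shows "P t"
proof -
  interpret V: module K V by fact
  interpret W: module K W by fact
  have K: "cring K" ..
  let ?S = "carrier V \<times> carrier W"
  let ?F = "free_space K ?S"
  interpret F: module K ?F by (rule free_space_module[OF K])
  note Q = quotient_space_simps[OF tensor_null_submodule[OF V W], folded tensor_space_def]
  from t obtain f where f: "f \<in> carrier ?F" "t = tensor_null K V W +>\<^bsub>?F\<^esub> f" by (auto simp: Q(1))
  from K f(1) have "P (tensor_null K V W +>\<^bsub>?F\<^esub> f)"
  proof (induction f rule: free_space_induct)
    case zero
    have "tensor K V W \<zero>\<^bsub>V\<^esub> \<zero>\<^bsub>W\<^esub> = \<zero>\<^bsub>tensor_space K V W\<^esub>"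
      using module_hom_zero[OF W tensor_space_module[OF V W] tensor_hom_right[OF V W V.zero_closed]] .
    then show ?case using tensor[of "\<zero>\<^bsub>V\<^esub>" "\<zero>\<^bsub>W\<^esub>"] by (simp add: Q(2))
  next
    case (add c s f)
    obtain v w where s: "s = (v, w)" and vw: "v \<in> carrier V" "w \<in> carrier W" using add by auto
    let ?t = "tensor_null K V W +>\<^bsub>?F\<^esub> f"
    have "tensor K V W (c \<odot>\<^bsub>V\<^esub> v) w \<oplus>\<^bsub>tensor_space K V W\<^esub> ?t
      = tensor_null K V W +>\<^bsub>?F\<^esub> ((c \<odot>\<^bsub>?F\<^esub> free_gen K ?S (v, w)) \<oplus>\<^bsub>?F\<^esub> f)"
      using module_hom_smult[OF tensor_hom_left[OF V W vw(2)] add(1) vw(1)] add(1,3) vw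
        free_gen_in[OF K, of "(v, w)" ?S]
      by (simp add: tensor_def Q)
    moreover have "P (tensor K V W (c \<odot>\<^bsub>V\<^esub> v) w \<oplus>\<^bsub>tensor_space K V W\<^esub> ?t)"
      using add vw by (intro assms(5) tensor tensor_in V W) (auto simp: Q(1))
    ultimately show ?case by (simp add: s)
  qed
  then show ?thesis using f by simp
qed

text \<open>The uniqueness half of the universal property. Almost every identity between operators
  below is reduced to pure tensors through it.\<close>

lemma module_hom_tensor_eqI:
  assumes V: "module K V" and W: "module K W"
    and f: "f \<in> module_hom K (tensor_space K V W) Z"
    and g: "g \<in> module_hom K (tensor_space K V W) Z"
    and eq: "\<And>v w. v \<in> carrier V \<Longrightarrow> w \<in> carrier W \<Longrightarrow> f (tensor K V W v w) = g (tensor K V W v w)"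
    and t: "t \<in> carrier (tensor_space K V W)"
  shows "f t = g t"
  using V W t
  by (induction t rule: tensor_induct) (simp_all add: eq module_hom_add[OF f] module_hom_add[OF g])

text \<open>Bilinearity puts the defining relations into the kernel of the linear extension. The
  kernel is a submodule, so it contains their span, and the extension is constant on cosets.\<close>

lemma tensor_lift_coset:
  assumes V: "module K V" and W: "module K W" and Z: "module K Z"
    and B: "bilinear_map K V W Z B"
    and f: "f \<in> carrier (free_space K (carrier V \<times> carrier W))"
  shows "tensor_lift K V W Z B (tensor_null K V W +>\<^bsub>free_space K (carrier V \<times> carrier W)\<^esub> f)
    = free_lift K (carrier V \<times> carrier W) Z (\<lambda>p. B (fst p) (snd p)) f"
proof -
  interpret V: module K V by fact
  interpret W: module K W by fact
  interpret Z: module K Z by fact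
  have K: "cring K" ..
  let ?S = "carrier V \<times> carrier W"
  let ?F = "free_space K ?S"
  interpret F: module K ?F by (rule free_space_module[OF K])
  let ?b = "\<lambda>p. B (fst p) (snd p)"
  let ?\<phi> = "free_lift K ?S Z ?b"
  have b: "?b \<in> ?S \<rightarrow> carrier Z" using bilinear_map_in[OF B] by auto
  have \<phi>: "?\<phi> \<in> module_hom K ?F Z" by (rule free_lift_hom[OF Z b])
  interpret \<phi>: mod_hom K ?F Z ?\<phi>
    using \<phi> by (simp add: mod_hom_def mod_hom_axioms_def Z F.module_axioms)
  have g: "free_gen K ?S (v, w) \<in> carrier ?F" if "v \<in> carrier V" "w \<in> carrier W" for v w
    using that by (intro free_gen_in[OF K]) auto
  have \<phi>g: "?\<phi> (free_gen K ?S (v, w)) = B v w" if "v \<in> carrier V" "w \<in> carrier W" for v w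
    using free_lift_gen[OF Z b, of "(v, w)"] that by simp
  note hom = bilinear_map_left[OF B] bilinear_map_right[OF B]
  have "tensor_relations K V W \<subseteq> \<phi>.ker"
    unfolding tensor_relations_def Let_def \<phi>.ker_def
    by (auto simp: g \<phi>g module_hom_add[OF hom(1)] module_hom_add[OF hom(2)]
        module_hom_smult[OF hom(1)] module_hom_smult[OF hom(2)] bilinear_map_in[OF B] )
  then have null: "tensor_null K V W \<subseteq> \<phi>.ker"
    unfolding tensor_null_def by (rule F.span_is_subset) (rule \<phi>.ker_is_submodule)
  interpret N: abelian_subgroup "tensor_null K V W" ?F
    by (rule submodule_abelian_subgroup[OF tensor_null_submodule[OF V W]])
  have "?\<phi> h = ?\<phi> f" if "h \<in> tensor_null K V W +>\<^bsub>?F\<^esub> f" for h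
  proof -
    from that obtain n where n: "n \<in> tensor_null K V W" "h = n \<oplus>\<^bsub>?F\<^esub> f"
      by (auto simp: a_r_coset_def')
    then have "n \<in> carrier ?F" "?\<phi> n = \<zero>\<^bsub>Z\<^esub>" using null by (auto simp: \<phi>.ker_def)
    then show ?thesis using n f module_hom_in[OF \<phi> f] by simp
  qed
  moreover have "f \<in> tensor_null K V W +>\<^bsub>?F\<^esub> f" using f by (rule N.a_rcos_self)
  \<comment> \<open>The image of the coset is a singleton, which is what gives
    \<open>the_elem\<close> in \<open>tensor_lift\<close> its meaning.\<close>
  ultimately have "?\<phi> ` (tensor_null K V W +>\<^bsub>?F\<^esub> f) = {?\<phi> f}" by blast
  moreover have "tensor_lift K V W Z B A = the_elem (?\<phi> ` A)" for A
    by (simp only: tensor_lift_def free_lift_def[abs_def])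
  ultimately show ?thesis by simp
qed

lemma tensor_lift_tensor:
  assumes V: "module K V" and W: "module K W" and Z: "module K Z"
    and B: "bilinear_map K V W Z B" and v: "v \<in> carrier V" and w: "w \<in> carrier W"
  shows "tensor_lift K V W Z B (tensor K V W v w) = B v w"
proof -
  interpret V: module K V by fact
  have K: "cring K" ..
  have "(\<lambda>p. B (fst p) (snd p)) \<in> carrier V \<times> carrier W \<rightarrow> carrier Z"
    using bilinear_map_in[OF B] by auto
  from free_lift_gen[OF Z this, of "(v, w)"] show ?thesis
    unfolding tensor_def using v w
    by (subst tensor_lift_coset[OF V W Z B]) (auto intro!: free_gen_in[OF K])
qed

lemma tensor_lift_hom:
  assumes V: "module K V" and W: "module K W" and Z: "module K Z"
    and B: "bilinear_map K V W Z B"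
  shows "tensor_lift K V W Z B \<in> module_hom K (tensor_space K V W) Z"
proof -
  interpret V: module K V by fact
  have K: "cring K" ..
  let ?S = "carrier V \<times> carrier W"
  let ?F = "free_space K ?S"
  interpret F: module K ?F by (rule free_space_module[OF K])
  note Q = quotient_space_simps[OF tensor_null_submodule[OF V W], folded tensor_space_def]
  let ?b = "\<lambda>p. B (fst p) (snd p)"
  have b: "?b \<in> ?S \<rightarrow> carrier Z" using bilinear_map_in[OF B] by auto
  note \<phi> = free_lift_hom[OF Z b]
  show ?thesis
    by (rule module_homI)
      (auto simp: Q tensor_lift_coset[OF V W Z B] module_hom_in[OF \<phi>] module_hom_add[OF \<phi>]
        module_hom_smult[OF \<phi>])
qed

text \<open>A lift depends linearly on a parameter if the bilinear map does: clear on pure tensors,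
  and preserved by sums of homomorphisms. This makes it possible to nest lifts.\<close>

lemma tensor_lift_param:
  assumes V: "module K V" and W: "module K W" and P: "module K P" and Z: "module K Z"
    and B: "\<And>p. p \<in> carrier P \<Longrightarrow> bilinear_map K V W Z (B p)"
    and lin: "\<And>v w. v \<in> carrier V \<Longrightarrow> w \<in> carrier W \<Longrightarrow> (\<lambda>p. B p v w) \<in> module_hom K P Z"
    and t: "t \<in> carrier (tensor_space K V W)"
  shows "(\<lambda>p. tensor_lift K V W Z (B p) t) \<in> module_hom K P Z"
  using V W t
proof (induction t rule: tensor_induct)
  case (tensor v w)
  show ?case
    by (rule module_hom_cong[OF lin[OF tensor] P]) (simp add: tensor_lift_tensor[OF V W Z B] tensor)
next
  case (add s t)
  show ?case
    by (rule module_hom_cong[OF module_hom_plus[OF Z add(3,4)] P])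
      (simp add: module_hom_add[OF tensor_lift_hom[OF V W Z B]] add)
qed

text \<open>For nested lifts out of a triple product bracketed to the left; the companion that
  follows serves products bracketed to the right.\<close>

lemma bilinear_map_tensor_lift_left:
  assumes V: "module K V" and W: "module K W" and P: "module K P" and Z: "module K Z"
    and B: "\<And>p. p \<in> carrier P \<Longrightarrow> bilinear_map K V W Z (B p)"
    and lin: "\<And>v w. v \<in> carrier V \<Longrightarrow> w \<in> carrier W \<Longrightarrow> (\<lambda>p. B p v w) \<in> module_hom K P Z"
  shows "bilinear_map K (tensor_space K V W) P Z (\<lambda>t p. tensor_lift K V W Z (B p) t)"
  by (intro bilinear_mapI tensor_lift_param[OF assms] tensor_lift_hom[OF V W Z B])

lemma bilinear_map_tensor_lift_right:
  assumes V: "module K V" and W: "module K W" and P: "module K P" and Z: "module K Z"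
    and B: "\<And>p. p \<in> carrier P \<Longrightarrow> bilinear_map K V W Z (B p)"
    and lin: "\<And>v w. v \<in> carrier V \<Longrightarrow> w \<in> carrier W \<Longrightarrow> (\<lambda>p. B p v w) \<in> module_hom K P Z"
  shows "bilinear_map K P (tensor_space K V W) Z (\<lambda>p. tensor_lift K V W Z (B p))"
  by (intro bilinear_mapI tensor_lift_param[OF assms] tensor_lift_hom[OF V W Z B])

lemma bilinear_map_comp:
  assumes B: "bilinear_map K V W Z B" and f: "f \<in> module_hom K V' V" and g: "g \<in> module_hom K W' W"
  shows "bilinear_map K V' W' Z (\<lambda>v w. B (f v) (g w))"
proof (rule bilinear_mapI)
  show "(\<lambda>w. B (f v) (g w)) \<in> module_hom K W' Z" if "v \<in> carrier V'" for v
    by (rule module_hom_comp[OF bilinear_map_right[OF B module_hom_in[OF f that]] g])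
  show "(\<lambda>v. B (f v) (g w)) \<in> module_hom K V' Z" if "w \<in> carrier W'" for w
    by (rule module_hom_comp[OF bilinear_map_left[OF B module_hom_in[OF g that]] f])
qed

lemma bilinear_map_hom_comp:
  assumes B: "bilinear_map K V W Z B" and h: "h \<in> module_hom K Z Z'"
  shows "bilinear_map K V W Z' (\<lambda>v w. h (B v w))"
proof (rule bilinear_mapI)
  show "(\<lambda>w. h (B v w)) \<in> module_hom K W Z'" if "v \<in> carrier V" for v
    by (rule module_hom_comp[OF h bilinear_map_right[OF B that]])
  show "(\<lambda>v. h (B v w)) \<in> module_hom K V Z'" if "w \<in> carrier W" for w
    by (rule module_hom_comp[OF h bilinear_map_left[OF B that]])
qed

lemma bilinear_map_plus:
  assumes Z: "module K Z" and B: "bilinear_map K V W Z B" and C: "bilinear_map K V W Z C"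
  shows "bilinear_map K V W Z (\<lambda>v w. B v w \<oplus>\<^bsub>Z\<^esub> C v w)"
  by (rule bilinear_mapI)
    (rule module_hom_plus[OF Z bilinear_map_right[OF B] bilinear_map_right[OF C]]
      module_hom_plus[OF Z bilinear_map_left[OF B] bilinear_map_left[OF C]]; assumption)+

lemma bilinear_map_flip:
  "bilinear_map K V W Z B \<Longrightarrow> bilinear_map K W V Z (\<lambda>w v. B v w)"
  by (simp add: bilinear_map_def)

lemma bilinear_map_uminus:
  assumes Z: "module K Z" and B: "bilinear_map K V W Z B"
  shows "bilinear_map K V W Z (\<lambda>v w. \<ominus>\<^bsub>Z\<^esub> B v w)"
  by (intro bilinear_mapI module_hom_uminus[OF Z] bilinear_map_right[OF B] bilinear_map_left[OF B])

text \<open>Bilinearity of \<open>B\<close> follows from its agreement with the composite of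
  \<open>h\<close> and \<open>tensor\<close>. A lift can thus be identified from its values alone,
  which is how the nested lifts in \<open>lie_R\<close> are resolved later.\<close>

lemma tensor_lift_unique:
  assumes V: "module K V" and W: "module K W" and Z: "module K Z"
    and h: "h \<in> module_hom K (tensor_space K V W) Z"
    and B: "\<And>v w. v \<in> carrier V \<Longrightarrow> w \<in> carrier W \<Longrightarrow> B v w = h (tensor K V W v w)"
    and t: "t \<in> carrier (tensor_space K V W)"
  shows "tensor_lift K V W Z B t = h t"
proof -
  note hb = bilinear_map_hom_comp[OF tensor_bilinear[OF V W] h]
  have b: "bilinear_map K V W Z B"
  proof (rule bilinear_mapI)
    show "(\<lambda>w. B v w) \<in> module_hom K W Z" if "v \<in> carrier V" for v
      by (rule module_hom_cong[OF bilinear_map_right[OF hb that] W B[OF that]])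
    show "(\<lambda>v. B v w) \<in> module_hom K V Z" if "w \<in> carrier W" for w
      by (rule module_hom_cong[OF bilinear_map_left[OF hb that] V B[OF _ that]])
  qed
  show ?thesis
    by (rule module_hom_tensor_eqI[OF V W tensor_lift_hom[OF V W Z b] h _ t])
      (simp add: tensor_lift_tensor[OF V W Z b] B)
qed

section \<open>Tensor products of maps and associators\<close>

lemma
  assumes V: "module K V" and W: "module K W" and V': "module K V'" and W': "module K W'"
    and f: "f \<in> module_hom K V V'" and g: "g \<in> module_hom K W W'"
  shows tensor_map_hom:
      "tensor_map K V W V' W' f g \<in> module_hom K (tensor_space K V W) (tensor_space K V' W')"
    and tensor_map_tensor: "\<lbrakk>v \<in> carrier V; w \<in> carrier W\<rbrakk> \<Longrightarrow>
      tensor_map K V W V' W' f g (tensor K V W v w) = tensor K V' W' (f v) (g w)"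
proof -
  have B: "bilinear_map K V W (tensor_space K V' W') (\<lambda>v w. tensor K V' W' (f v) (g w))"
    by (rule bilinear_map_comp[OF tensor_bilinear[OF V' W'] f g])
  note Z = tensor_space_module[OF V' W']
  show "tensor_map K V W V' W' f g \<in> module_hom K (tensor_space K V W) (tensor_space K V' W')"
    unfolding tensor_map_def by (rule tensor_lift_hom[OF V W Z B])
  show "tensor_map K V W V' W' f g (tensor K V W v w) = tensor K V' W' (f v) (g w)"
    if "v \<in> carrier V" "w \<in> carrier W"
    unfolding tensor_map_def by (rule tensor_lift_tensor[OF V W Z B that])
qed

lemma
  assumes U: "module K U" and V: "module K V" and W: "module K W"
  shows assoc_left_hom: "assoc_left K U V W \<in> module_hom K
      (tensor_space K U (tensor_space K V W)) (tensor_space K (tensor_space K U V) W)"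
    and assoc_left_tensor: "\<lbrakk>u \<in> carrier U; v \<in> carrier V; w \<in> carrier W\<rbrakk> \<Longrightarrow>
      assoc_left K U V W (tensor K U (tensor_space K V W) u (tensor K V W v w))
      = tensor K (tensor_space K U V) W (tensor K U V u v) w"
proof -
  note UV = tensor_space_module[OF U V]
  note VW = tensor_space_module[OF V W]
  let ?Z = "tensor_space K (tensor_space K U V) W"
  note Z = tensor_space_module[OF UV W]
  have B: "bilinear_map K V W ?Z (\<lambda>v w. tensor K (tensor_space K U V) W (tensor K U V u v) w)"
    if "u \<in> carrier U" for u
    by (rule bilinear_map_comp[OF tensor_bilinear[OF UV W] tensor_hom_right[OF U V that]
          module_hom_id[OF W]])
  have lin: "(\<lambda>u. tensor K (tensor_space K U V) W (tensor K U V u v) w) \<in> module_hom K U ?Z"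
    if "v \<in> carrier V" "w \<in> carrier W" for v w
    by (rule module_hom_comp[OF tensor_hom_left[OF UV W that(2)] tensor_hom_left[OF U V that(1)]])
  note C = bilinear_map_tensor_lift_right[OF V W U Z B lin]
  show "assoc_left K U V W \<in> module_hom K
      (tensor_space K U (tensor_space K V W)) (tensor_space K (tensor_space K U V) W)"
    unfolding assoc_left_def Let_def by (rule tensor_lift_hom[OF U VW Z C])
  show "assoc_left K U V W (tensor K U (tensor_space K V W) u (tensor K V W v w))
      = tensor K (tensor_space K U V) W (tensor K U V u v) w"
    if "u \<in> carrier U" "v \<in> carrier V" "w \<in> carrier W"
    unfolding assoc_left_def Let_def
    by (simp add: tensor_lift_tensor[OF U VW Z C] tensor_lift_tensor[OF V W Z B] that U V W)
qed

lemma
  assumes U: "module K U" and V: "module K V" and W: "module K W"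
  shows assoc_right_hom: "assoc_right K U V W \<in> module_hom K
      (tensor_space K (tensor_space K U V) W) (tensor_space K U (tensor_space K V W))"
    and assoc_right_tensor: "\<lbrakk>u \<in> carrier U; v \<in> carrier V; w \<in> carrier W\<rbrakk> \<Longrightarrow>
      assoc_right K U V W (tensor K (tensor_space K U V) W (tensor K U V u v) w)
      = tensor K U (tensor_space K V W) u (tensor K V W v w)"
proof -
  note UV = tensor_space_module[OF U V]
  note VW = tensor_space_module[OF V W]
  let ?Z = "tensor_space K U (tensor_space K V W)"
  note Z = tensor_space_module[OF U VW]
  have B: "bilinear_map K U V ?Z (\<lambda>u v. tensor K U (tensor_space K V W) u (tensor K V W v w))"
    if "w \<in> carrier W" for w
    by (rule bilinear_map_comp[OF tensor_bilinear[OF U VW] module_hom_id[OF U]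
          tensor_hom_left[OF V W that]])
  have lin: "(\<lambda>w. tensor K U (tensor_space K V W) u (tensor K V W v w)) \<in> module_hom K W ?Z"
    if "u \<in> carrier U" "v \<in> carrier V" for u v
    by (rule module_hom_comp[OF tensor_hom_right[OF U VW that(1)] tensor_hom_right[OF V W that(2)]])
  note C = bilinear_map_tensor_lift_left[OF U V W Z B lin]
  show "assoc_right K U V W \<in> module_hom K
      (tensor_space K (tensor_space K U V) W) (tensor_space K U (tensor_space K V W))"
    unfolding assoc_right_def Let_def by (rule tensor_lift_hom[OF UV W Z C])
  show "assoc_right K U V W (tensor K (tensor_space K U V) W (tensor K U V u v) w)
      = tensor K U (tensor_space K V W) u (tensor K V W v w)"
    if "u \<in> carrier U" "v \<in> carrier V" "w \<in> carrier W"
    unfolding assoc_right_def Let_def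
    by (simp add: tensor_lift_tensor[OF UV W Z C] tensor_lift_tensor[OF U V Z B] that U V W)
qed

text \<open>Uniqueness is applied twice, first to the outer product and then, with \<open>u\<close>
  fixed, to the inner one.\<close>

lemma module_hom_tensor3_eqI:
  assumes U: "module K U" and V: "module K V" and W: "module K W" and Z: "module K Z"
    and f: "f \<in> module_hom K (tensor_space K U (tensor_space K V W)) Z"
    and g: "g \<in> module_hom K (tensor_space K U (tensor_space K V W)) Z"
    and eq: "\<And>u v w. u \<in> carrier U \<Longrightarrow> v \<in> carrier V \<Longrightarrow> w \<in> carrier W \<Longrightarrow>
      f (tensor K U (tensor_space K V W) u (tensor K V W v w))
      = g (tensor K U (tensor_space K V W) u (tensor K V W v w))"
    and t: "t \<in> carrier (tensor_space K U (tensor_space K V W))"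
  shows "f t = g t"
proof (rule module_hom_tensor_eqI[OF U tensor_space_module[OF V W] f g _ t])
  fix u x assume u: "u \<in> carrier U" and x: "x \<in> carrier (tensor_space K V W)"
  note h = tensor_hom_right[OF U tensor_space_module[OF V W] u]
  show "f (tensor K U (tensor_space K V W) u x) = g (tensor K U (tensor_space K V W) u x)"
    by (rule module_hom_tensor_eqI[OF V W module_hom_comp[OF f h] module_hom_comp[OF g h] _ x])
      (rule eq[OF u])
qed

lemma
  assumes V: "module K V" and W: "module K W" and v: "v \<in> carrier V" and w: "w \<in> carrier W"
  shows tensor_add_left: "v' \<in> carrier V \<Longrightarrow>
      tensor K V W (v \<oplus>\<^bsub>V\<^esub> v') w = tensor K V W v w \<oplus>\<^bsub>tensor_space K V W\<^esub> tensor K V W v' w"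
    and tensor_add_right: "w' \<in> carrier W \<Longrightarrow>
      tensor K V W v (w \<oplus>\<^bsub>W\<^esub> w') = tensor K V W v w \<oplus>\<^bsub>tensor_space K V W\<^esub> tensor K V W v w'"
  using module_hom_add[OF tensor_hom_left[OF V W w] v]
    module_hom_add[OF tensor_hom_right[OF V W v] w]
  by blast+

lemma
  assumes V: "module K V" and W: "module K W"
  shows tensor_zero_left: "w \<in> carrier W \<Longrightarrow>
      tensor K V W \<zero>\<^bsub>V\<^esub> w = \<zero>\<^bsub>tensor_space K V W\<^esub>"
    and tensor_zero_right: "v \<in> carrier V \<Longrightarrow>
      tensor K V W v \<zero>\<^bsub>W\<^esub> = \<zero>\<^bsub>tensor_space K V W\<^esub>"
  using module_hom_zero[OF V tensor_space_module[OF V W] tensor_hom_left[OF V W]]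
    module_hom_zero[OF W tensor_space_module[OF V W] tensor_hom_right[OF V W]]
  by blast+

lemmas tensor_simps = tensor_add_left tensor_add_right tensor_zero_left tensor_zero_right

section \<open>Derivations on a tensor product\<close>

text \<open>The operator \<open>f \<otimes> 1 + 1 \<otimes> g\<close>, by which an algebra element
  acts on a tensor product when it acts by \<open>f\<close> and \<open>g\<close> on the
  factors.\<close>

definition tensor_derivation ::
  "('k, 'm) ring_scheme \<Rightarrow> ('k, 'v, 'n1) module_scheme \<Rightarrow> ('k, 'w, 'n2) module_scheme
    \<Rightarrow> ('v \<Rightarrow> 'v) \<Rightarrow> ('w \<Rightarrow> 'w) \<Rightarrow> ('v \<times> 'w \<Rightarrow> 'k) set \<Rightarrow> ('v \<times> 'w \<Rightarrow> 'k) set" where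
  "tensor_derivation K V W f g = tensor_lift K V W (tensor_space K V W)
     (\<lambda>v w. tensor K V W (f v) w \<oplus>\<^bsub>tensor_space K V W\<^esub> tensor K V W v (g w))"

lemma
  assumes V: "module K V" and W: "module K W"
    and f: "f \<in> module_hom K V V" and g: "g \<in> module_hom K W W"
  shows tensor_derivation_bilinear: "bilinear_map K V W (tensor_space K V W)
      (\<lambda>v w. tensor K V W (f v) w \<oplus>\<^bsub>tensor_space K V W\<^esub> tensor K V W v (g w))"
    and tensor_derivation_hom:
      "tensor_derivation K V W f g \<in> module_hom K (tensor_space K V W) (tensor_space K V W)"
    and tensor_derivation_tensor: "\<lbrakk>v \<in> carrier V; w \<in> carrier W\<rbrakk> \<Longrightarrow>
      tensor_derivation K V W f g (tensor K V W v w)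
      = tensor K V W (f v) w \<oplus>\<^bsub>tensor_space K V W\<^esub> tensor K V W v (g w)"
proof -
  note Z = tensor_space_module[OF V W]
  show B: "bilinear_map K V W (tensor_space K V W)
      (\<lambda>v w. tensor K V W (f v) w \<oplus>\<^bsub>tensor_space K V W\<^esub> tensor K V W v (g w))"
    by (rule bilinear_map_plus[OF Z bilinear_map_comp[OF tensor_bilinear[OF V W] f module_hom_id[OF W]]
          bilinear_map_comp[OF tensor_bilinear[OF V W] module_hom_id[OF V] g]])
  show "tensor_derivation K V W f g \<in> module_hom K (tensor_space K V W) (tensor_space K V W)"
    unfolding tensor_derivation_def by (rule tensor_lift_hom[OF V W Z B])
  show "tensor_derivation K V W f g (tensor K V W v w)
      = tensor K V W (f v) w \<oplus>\<^bsub>tensor_space K V W\<^esub> tensor K V W v (g w)"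
    if "v \<in> carrier V" "w \<in> carrier W"
    unfolding tensor_derivation_def by (rule tensor_lift_tensor[OF V W Z B that])
qed

text \<open>The sum that arises when the inverse formula is applied to the four terms of the
  braiding. Here \<open>s\<close> and \<open>t\<close> are the terms over
  \<open>e \<otimes> e\<close> that carry the two actions in opposite orders.\<close>

lemma (in abelian_group) braid_cancel:
  assumes "p \<in> carrier G" "q \<in> carrier G" "r \<in> carrier G" "s \<in> carrier G" "t \<in> carrier G"
  shows "(p \<oplus> \<ominus> q \<oplus> \<ominus> r \<oplus> s) \<oplus> (q \<oplus> \<ominus> s) \<oplus> (r \<oplus> \<ominus> t) \<oplus> t = p"
proof -
  have "(p \<oplus> \<ominus> q \<oplus> \<ominus> r \<oplus> s) \<oplus> (q \<oplus> \<ominus> s) \<oplus> (r \<oplus> \<ominus> t) \<oplus> t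
      = p \<oplus> (q \<oplus> \<ominus> q) \<oplus> (r \<oplus> \<ominus> r) \<oplus> (s \<oplus> \<ominus> s) \<oplus> (t \<oplus> \<ominus> t)"
    using assms by (simp only: a_ac a_closed a_inv_closed)
  also have "\<dots> = p" using assms by (simp add: r_neg)
  finally show ?thesis .
qed

text \<open>The corresponding sum for the composite in the other order.\<close>

lemma (in abelian_group) braid_cancel':
  assumes "p \<in> carrier G" "q \<in> carrier G" "r \<in> carrier G" "s \<in> carrier G" "t \<in> carrier G"
  shows "(p \<oplus> q \<oplus> r \<oplus> s) \<oplus> \<ominus> (q \<oplus> t) \<oplus> \<ominus> (r \<oplus> s) \<oplus> t = p"
proof -
  have "(p \<oplus> q \<oplus> r \<oplus> s) \<oplus> \<ominus> (q \<oplus> t) \<oplus> \<ominus> (r \<oplus> s) \<oplus> t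
      = p \<oplus> (q \<oplus> \<ominus> q) \<oplus> (r \<oplus> \<ominus> r) \<oplus> (s \<oplus> \<ominus> s) \<oplus> (t \<oplus> \<ominus> t)"
    using assms by (simp only: minus_add a_ac a_closed a_inv_closed)
  also have "\<dots> = p" using assms by (simp add: r_neg)
  finally show ?thesis .
qed

section \<open>The braiding attached to a Leibniz algebra with a central element\<close>

text \<open>A right Leibniz algebra: bracketing with \<open>y\<close> on the right is a derivation
  of \<open>b\<close>. The element \<open>e\<close> has zero bracket with everything, on either
  side.\<close>

locale central_leibniz = module K X for K (structure) and X (structure) +
  fixes b :: "'c \<Rightarrow> 'c \<Rightarrow> 'c" and e :: 'c
  assumes b_bilinear: "bilinear_map K X X X b"
    and e_in [simp, intro]: "e \<in> carrier X"
    and b_e_left: "x \<in> carrier X \<Longrightarrow> b e x = \<zero>\<^bsub>X\<^esub>"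
    and b_e_right: "x \<in> carrier X \<Longrightarrow> b x e = \<zero>\<^bsub>X\<^esub>"
    and leibniz: "x \<in> carrier X \<Longrightarrow> y \<in> carrier X \<Longrightarrow> z \<in> carrier X \<Longrightarrow>
      b x (b z y) \<oplus>\<^bsub>X\<^esub> b (b x y) z = b (b x z) y"
begin

section \<open>Actions and diagonal actions\<close>

text \<open>Right modules over the Leibniz algebra on which \<open>e\<close> acts as zero, with the
  acting element written first: the commutator of \<open>\<rho> y\<close> and
  \<open>\<rho> z\<close> is \<open>\<rho> (b z y)\<close>.\<close>

definition action :: "('a, 'v, 'n) module_scheme \<Rightarrow> ('c \<Rightarrow> 'v \<Rightarrow> 'v) \<Rightarrow> bool" where
  "action M \<rho> \<longleftrightarrow> bilinear_map K X M M \<rho> \<and> (\<forall>m\<in>carrier M. \<rho> e m = \<zero>\<^bsub>M\<^esub>) \<and>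
     (\<forall>y\<in>carrier X. \<forall>z\<in>carrier X. \<forall>m\<in>carrier M.
        \<rho> y (\<rho> z m) = \<rho> (b z y) m \<oplus>\<^bsub>M\<^esub> \<rho> z (\<rho> y m))"

lemma b_in [simp, intro]: "x \<in> carrier X \<Longrightarrow> y \<in> carrier X \<Longrightarrow> b x y \<in> carrier X"
  by (rule bilinear_map_in[OF b_bilinear])

text \<open>The commutator law for right bracketing is the Leibniz identity itself.\<close>

lemma action_X: "action X (\<lambda>z x. b x z)"
  using bilinear_map_flip[OF b_bilinear] by (auto simp: action_def b_e_right leibniz)

text \<open>Applying two diagonal actions to \<open>m \<otimes> n\<close> produces mixed terms that
  are symmetric in \<open>y\<close> and \<open>z\<close>. They agree on both sides of the commutator
  law, and what remains is that law in each factor.\<close>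

lemma action_tensor:
  assumes M: "module K M" and N: "module K N" and \<rho>: "action M \<rho>" and \<sigma>: "action N \<sigma>"
  shows "action (tensor_space K M N) (\<lambda>z. tensor_derivation K M N (\<rho> z) (\<sigma> z))"
proof -
  let ?MN = "tensor_space K M N"
  let ?D = "\<lambda>z. tensor_derivation K M N (\<rho> z) (\<sigma> z)"
  note MN = tensor_space_module[OF M N]
  have X: "module K X" by (rule module_axioms)
  have \<rho>b: "bilinear_map K X M M \<rho>" and \<sigma>b: "bilinear_map K X N N \<sigma>"
    using \<rho> \<sigma> by (auto simp: action_def)
  note \<rho>h = bilinear_map_right[OF \<rho>b] and \<sigma>h = bilinear_map_right[OF \<sigma>b]
  have Db: "bilinear_map K M N ?MN
      (\<lambda>m n. tensor K M N (\<rho> z m) n \<oplus>\<^bsub>?MN\<^esub> tensor K M N m (\<sigma> z n))"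
    and Dh: "?D z \<in> module_hom K ?MN ?MN"
    and Dt: "\<lbrakk>m \<in> carrier M; n \<in> carrier N\<rbrakk> \<Longrightarrow>
      ?D z (tensor K M N m n) = tensor K M N (\<rho> z m) n \<oplus>\<^bsub>?MN\<^esub> tensor K M N m (\<sigma> z n)"
    if "z \<in> carrier X" for z m n
    using tensor_derivation_bilinear[OF M N \<rho>h \<sigma>h, OF that that]
      tensor_derivation_hom[OF M N \<rho>h \<sigma>h, OF that that]
      tensor_derivation_tensor[OF M N \<rho>h \<sigma>h, OF that that] by blast+
  have [simp]: "\<rho> z m \<in> carrier M" if "z \<in> carrier X" "m \<in> carrier M" for z m
    using bilinear_map_in[OF \<rho>b that] .
  have [simp]: "\<sigma> z n \<in> carrier N" if "z \<in> carrier X" "n \<in> carrier N" for z n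
    using bilinear_map_in[OF \<sigma>b that] .
  interpret MN: module K ?MN by (rule MN)
  interpret M: module K M by (rule M)
  interpret N: module K N by (rule N)
  have lin: "(\<lambda>z. tensor K M N (\<rho> z m) n \<oplus>\<^bsub>?MN\<^esub> tensor K M N m (\<sigma> z n)) \<in> module_hom K X ?MN"
    if "m \<in> carrier M" "n \<in> carrier N" for m n
    by (rule module_hom_plus[OF MN
          module_hom_comp[OF tensor_hom_left[OF M N that(2)] bilinear_map_left[OF \<rho>b that(1)]]
          module_hom_comp[OF tensor_hom_right[OF M N that(1)] bilinear_map_left[OF \<sigma>b that(2)]]])
  have "bilinear_map K X ?MN ?MN ?D"
    unfolding tensor_derivation_def
    by (rule bilinear_map_tensor_lift_right[OF M N X MN Db lin])
  moreover have "?D e t = \<zero>\<^bsub>?MN\<^esub>" if "t \<in> carrier ?MN" for t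
    by (rule module_hom_tensor_eqI[OF M N Dh module_hom_const_zero[OF MN] _ that])
      (use \<rho> \<sigma> in \<open>simp_all add: Dt action_def tensor_simps M N\<close>)
  moreover have "?D y (?D z t) = ?D (b z y) t \<oplus>\<^bsub>?MN\<^esub> ?D z (?D y t)"
    if y: "y \<in> carrier X" and z: "z \<in> carrier X" and t: "t \<in> carrier ?MN" for y z t
  proof (rule module_hom_tensor_eqI[OF M N module_hom_comp[OF Dh[OF y] Dh[OF z]]
          module_hom_plus[OF MN Dh[OF b_in[OF z y]] module_hom_comp[OF Dh[OF z] Dh[OF y]]] _ t])
    fix m n assume mn: "m \<in> carrier M" "n \<in> carrier N"
    have "\<rho> y (\<rho> z m) = \<rho> (b z y) m \<oplus>\<^bsub>M\<^esub> \<rho> z (\<rho> y m)"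
        "\<sigma> y (\<sigma> z n) = \<sigma> (b z y) n \<oplus>\<^bsub>N\<^esub> \<sigma> z (\<sigma> y n)"
      using \<rho> \<sigma> y z mn unfolding action_def by blast+
    then show "?D y (?D z (tensor K M N m n))
        = ?D (b z y) (tensor K M N m n) \<oplus>\<^bsub>?MN\<^esub> ?D z (?D y (tensor K M N m n))"
      using mn y z
      by (simp add: Dt module_hom_add[OF Dh] M N tensor_simps MN.M.a_ac)
  qed
  ultimately show ?thesis unfolding action_def by blast
qed

abbreviation V where "V \<equiv> tensor_space K X X"
abbreviation VV where "VV \<equiv> tensor_space K V V"
abbreviation D where "D z \<equiv> tensor_derivation K X X (\<lambda>x. b x z) (\<lambda>x. b x z)"
abbreviation DD where "DD z \<equiv> tensor_derivation K V V (D z) (D z)"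

lemma X_module [simp, intro]: "module K X"
  by (rule module_axioms)

lemma V_module: "module K V"
  by simp

lemma action_D: "action V D"
  by (rule action_tensor[OF X_module X_module action_X action_X])

lemma action_DD: "action VV DD"
  by (intro action_tensor tensor_space_module X_module action_D)

lemma action_bilinear: "action M \<rho> \<Longrightarrow> bilinear_map K X M M \<rho>"
  by (simp add: action_def)

lemma action_e: "action M \<rho> \<Longrightarrow> m \<in> carrier M \<Longrightarrow> \<rho> e m = \<zero>\<^bsub>M\<^esub>"
  by (simp add: action_def)

lemma action_comm:
  "\<lbrakk>action M \<rho>; y \<in> carrier X; z \<in> carrier X; m \<in> carrier M\<rbrakk> \<Longrightarrow>
    \<rho> y (\<rho> z m) = \<rho> (b z y) m \<oplus>\<^bsub>M\<^esub> \<rho> z (\<rho> y m)"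
  unfolding action_def by blast

lemmas action_in = bilinear_map_in[OF action_bilinear]
lemmas action_hom = bilinear_map_right[OF action_bilinear]
lemmas action_add = module_hom_add[OF action_hom]
lemmas action_param = bilinear_map_left[OF action_bilinear]

section \<open>The braiding past an arbitrary module and its inverse\<close>

text \<open>The module \<open>S\<close> is a parameter because two instances are compared:
  \<open>V\<close>, which gives the operator under study, and \<open>VV\<close>, which gives the
  passage of two factors at once.\<close>

definition braid_pure ::
  "('a, 's, 'n) module_scheme \<Rightarrow> ('c \<Rightarrow> 's \<Rightarrow> 's) \<Rightarrow> 's \<Rightarrow> 'c \<Rightarrow> 'c
    \<Rightarrow> (('c \<times> 'c \<Rightarrow> 'a) set \<times> 's \<Rightarrow> 'a) set" where
  "braid_pure S \<rho> s z w =
     tensor K V S (tensor K X X z w) s \<oplus>\<^bsub>tensor_space K V S\<^esub>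
     tensor K V S (tensor K X X z e) (\<rho> w s) \<oplus>\<^bsub>tensor_space K V S\<^esub>
     tensor K V S (tensor K X X e w) (\<rho> z s) \<oplus>\<^bsub>tensor_space K V S\<^esub>
     tensor K V S (tensor K X X e e) (\<rho> w (\<rho> z s))"

definition braid ::
  "('a, 's, 'n) module_scheme \<Rightarrow> ('c \<Rightarrow> 's \<Rightarrow> 's)
    \<Rightarrow> ('s \<times> ('c \<times> 'c \<Rightarrow> 'a) set \<Rightarrow> 'a) set \<Rightarrow> (('c \<times> 'c \<Rightarrow> 'a) set \<times> 's \<Rightarrow> 'a) set" where
  "braid S \<rho> = tensor_lift K S V (tensor_space K V S)
     (\<lambda>s. tensor_lift K X X (tensor_space K V S) (braid_pure S \<rho> s))"

definition braid_inv_pure ::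
  "('a, 's, 'n) module_scheme \<Rightarrow> ('c \<Rightarrow> 's \<Rightarrow> 's) \<Rightarrow> 's \<Rightarrow> 'c \<Rightarrow> 'c
    \<Rightarrow> ('s \<times> ('c \<times> 'c \<Rightarrow> 'a) set \<Rightarrow> 'a) set" where
  "braid_inv_pure S \<rho> s z w =
     tensor K S V s (tensor K X X z w) \<oplus>\<^bsub>tensor_space K S V\<^esub>
     \<ominus>\<^bsub>tensor_space K S V\<^esub> tensor K S V (\<rho> w s) (tensor K X X z e) \<oplus>\<^bsub>tensor_space K S V\<^esub>
     \<ominus>\<^bsub>tensor_space K S V\<^esub> tensor K S V (\<rho> z s) (tensor K X X e w) \<oplus>\<^bsub>tensor_space K S V\<^esub>
     tensor K S V (\<rho> z (\<rho> w s)) (tensor K X X e e)"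

definition braid_inv ::
  "('a, 's, 'n) module_scheme \<Rightarrow> ('c \<Rightarrow> 's \<Rightarrow> 's)
    \<Rightarrow> (('c \<times> 'c \<Rightarrow> 'a) set \<times> 's \<Rightarrow> 'a) set \<Rightarrow> ('s \<times> ('c \<times> 'c \<Rightarrow> 'a) set \<Rightarrow> 'a) set" where
  "braid_inv S \<rho> = tensor_lift K V S (tensor_space K S V)
     (\<lambda>u s. tensor_lift K X X (tensor_space K S V) (braid_inv_pure S \<rho> s) u)"

context
  fixes S :: "('a, 's, 'n) module_scheme" and \<rho> :: "'c \<Rightarrow> 's \<Rightarrow> 's"
  assumes S: "module K S" and \<rho>: "action S \<rho>"
begin

lemma braid_pure_bilinear:
  assumes s: "s \<in> carrier S"
  shows "bilinear_map K X X (tensor_space K V S) (braid_pure S \<rho> s)"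
proof -
  note VS = tensor_space_module[OF V_module S]
  note t = tensor_bilinear[OF V_module S]
  note x = tensor_hom_left[OF X_module X_module e_in] tensor_hom_right[OF X_module X_module e_in]
  have ee: "tensor K X X e e \<in> carrier V" by simp
  show ?thesis
    unfolding braid_pure_def
    \<comment> \<open>One closure rule per summand, in the order of the definition. The last two
      summands are obtained as functions of \<open>w\<close> and \<open>z\<close> in this order and
      are then flipped.\<close>
    by (rule bilinear_map_plus[OF VS bilinear_map_plus[OF VS bilinear_map_plus[OF VS
      bilinear_map_hom_comp[OF tensor_bilinear[OF X_module X_module] tensor_hom_left[OF V_module S s]]
      bilinear_map_comp[OF t x(1) action_param[OF \<rho> s]]]
      bilinear_map_flip[OF bilinear_map_comp[OF t x(2) action_param[OF \<rho> s]]]]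
      bilinear_map_hom_comp[OF bilinear_map_flip[OF bilinear_map_comp[OF action_bilinear[OF \<rho>]
          module_hom_id[OF X_module] action_param[OF \<rho> s]]] tensor_hom_right[OF V_module S ee]]])
qed

lemma braid_pure_hom:
  assumes z: "z \<in> carrier X" and w: "w \<in> carrier X"
  shows "(\<lambda>s. braid_pure S \<rho> s z w) \<in> module_hom K S (tensor_space K V S)"
proof -
  note VS = tensor_space_module[OF V_module S]
  note h = tensor_hom_right[OF V_module S tensor_in[OF X_module X_module]]
  show ?thesis
    unfolding braid_pure_def
    by (rule module_hom_plus[OF VS module_hom_plus[OF VS module_hom_plus[OF VS
      h[OF z w] module_hom_comp[OF h[OF z e_in] action_hom[OF \<rho> w]]]
      module_hom_comp[OF h[OF e_in w] action_hom[OF \<rho> z]]]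
      module_hom_comp[OF h[OF e_in e_in] module_hom_comp[OF action_hom[OF \<rho> w] action_hom[OF \<rho> z]]]])
qed

lemma braid_hom: "braid S \<rho> \<in> module_hom K (tensor_space K S V) (tensor_space K V S)"
  unfolding braid_def
  by (rule tensor_lift_hom[OF S V_module tensor_space_module[OF V_module S]
      bilinear_map_tensor_lift_right[OF X_module X_module S tensor_space_module[OF V_module S]
        braid_pure_bilinear braid_pure_hom]])

lemma braid_tensor:
  assumes "s \<in> carrier S" "z \<in> carrier X" "w \<in> carrier X"
  shows "braid S \<rho> (tensor K S V s (tensor K X X z w)) = braid_pure S \<rho> s z w"
  unfolding braid_def
  using tensor_lift_tensor[OF S V_module tensor_space_module[OF V_module S]
      bilinear_map_tensor_lift_right[OF X_module X_module S tensor_space_module[OF V_module S]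
        braid_pure_bilinear braid_pure_hom] assms(1) tensor_in[OF X_module X_module assms(2,3)]]
    tensor_lift_tensor[OF X_module X_module tensor_space_module[OF V_module S]
      braid_pure_bilinear[OF assms(1)] assms(2,3)]
  by simp

lemma braid_inv_pure_bilinear:
  assumes s: "s \<in> carrier S"
  shows "bilinear_map K X X (tensor_space K S V) (braid_inv_pure S \<rho> s)"
proof -
  note SV = tensor_space_module[OF S V_module]
  note t = bilinear_map_flip[OF tensor_bilinear[OF S V_module]]
  note x = tensor_hom_left[OF X_module X_module e_in] tensor_hom_right[OF X_module X_module e_in]
  have ee: "tensor K X X e e \<in> carrier V" by simp
  show ?thesis
    unfolding braid_inv_pure_def
    by (rule bilinear_map_plus[OF SV bilinear_map_plus[OF SV bilinear_map_plus[OF SV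
      bilinear_map_hom_comp[OF tensor_bilinear[OF X_module X_module] tensor_hom_right[OF S V_module s]]
      bilinear_map_uminus[OF SV bilinear_map_comp[OF t x(1) action_param[OF \<rho> s]]]]
      bilinear_map_uminus[OF SV bilinear_map_flip[OF bilinear_map_comp[OF t x(2) action_param[OF \<rho> s]]]]]
      bilinear_map_hom_comp[OF bilinear_map_comp[OF action_bilinear[OF \<rho>]
          module_hom_id[OF X_module] action_param[OF \<rho> s]] tensor_hom_left[OF S V_module ee]]])
qed

lemma braid_inv_pure_hom:
  assumes z: "z \<in> carrier X" and w: "w \<in> carrier X"
  shows "(\<lambda>s. braid_inv_pure S \<rho> s z w) \<in> module_hom K S (tensor_space K S V)"
proof -
  note SV = tensor_space_module[OF S V_module]
  note h = tensor_hom_left[OF S V_module tensor_in[OF X_module X_module]]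
  show ?thesis
    unfolding braid_inv_pure_def
    by (rule module_hom_plus[OF SV module_hom_plus[OF SV module_hom_plus[OF SV
      h[OF z w] module_hom_uminus[OF SV module_hom_comp[OF h[OF z e_in] action_hom[OF \<rho> w]]]]
      module_hom_uminus[OF SV module_hom_comp[OF h[OF e_in w] action_hom[OF \<rho> z]]]]
      module_hom_comp[OF h[OF e_in e_in] module_hom_comp[OF action_hom[OF \<rho> z] action_hom[OF \<rho> w]]]])
qed

lemma braid_inv_hom: "braid_inv S \<rho> \<in> module_hom K (tensor_space K V S) (tensor_space K S V)"
  unfolding braid_inv_def
  by (rule tensor_lift_hom[OF V_module S tensor_space_module[OF S V_module]
      bilinear_map_tensor_lift_left[OF X_module X_module S tensor_space_module[OF S V_module]
        braid_inv_pure_bilinear braid_inv_pure_hom]])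

lemma braid_inv_tensor:
  assumes "s \<in> carrier S" "z \<in> carrier X" "w \<in> carrier X"
  shows "braid_inv S \<rho> (tensor K V S (tensor K X X z w) s) = braid_inv_pure S \<rho> s z w"
  unfolding braid_inv_def
  using tensor_lift_tensor[OF V_module S tensor_space_module[OF S V_module]
      bilinear_map_tensor_lift_left[OF X_module X_module S tensor_space_module[OF S V_module]
        braid_inv_pure_bilinear braid_inv_pure_hom] tensor_in[OF X_module X_module assms(2,3)] assms(1)]
    tensor_lift_tensor[OF X_module X_module tensor_space_module[OF S V_module]
      braid_inv_pure_bilinear[OF assms(1)] assms(2,3)]
  by simp

text \<open>Since \<open>e\<close> acts as zero, the four summands of the braiding expand under the
  inverse formula to four, two, two and one terms, which cancel as in \<open>braid_cancel\<close>.
  The reversed order of the actions in the inverse makes the two kinds of double action cancel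
  separately.\<close>

lemma braid_inv_braid_pure:
  assumes s: "s \<in> carrier S" and z: "z \<in> carrier X" and w: "w \<in> carrier X"
  shows "braid_inv S \<rho> (braid_pure S \<rho> s z w) = tensor K S V s (tensor K X X z w)"
proof -
  interpret SV: module K "tensor_space K S V" by (rule tensor_space_module[OF S V_module])
  interpret VS: module K "tensor_space K V S" by (rule tensor_space_module[OF V_module S])
  interpret S: module K S by (rule S)
  have neg_zero: "\<ominus>\<^bsub>tensor_space K S V\<^esub> \<zero>\<^bsub>tensor_space K S V\<^esub> = \<zero>\<^bsub>tensor_space K S V\<^esub>"
    by (rule SV.M.minus_equality) simp_all
  note [simp] = neg_zero action_in[OF \<rho>] action_e[OF \<rho>] s z w S module_hom_zero[OF S S action_hom[OF \<rho>]]
  show ?thesis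
    unfolding braid_pure_def
    by (simp add: module_hom_add[OF braid_inv_hom] braid_inv_tensor)
      (simp add: braid_inv_pure_def tensor_simps SV.M.braid_cancel)
qed

text \<open>The same count of four, two, two and one terms, now with the signs coming from the
  inverse formula; they cancel as in \<open>braid_cancel'\<close>.\<close>

lemma braid_braid_inv_pure:
  assumes s: "s \<in> carrier S" and z: "z \<in> carrier X" and w: "w \<in> carrier X"
  shows "braid S \<rho> (braid_inv_pure S \<rho> s z w) = tensor K V S (tensor K X X z w) s"
proof -
  interpret SV: module K "tensor_space K S V" by (rule tensor_space_module[OF S V_module])
  interpret VS: module K "tensor_space K V S" by (rule tensor_space_module[OF V_module S])
  interpret S: module K S by (rule S)
  note [simp] = action_in[OF \<rho>] action_e[OF \<rho>] s z w S module_hom_zero[OF S S action_hom[OF \<rho>]]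
    SV.module_axioms VS.module_axioms
  show ?thesis
    unfolding braid_inv_pure_def
    by (simp add: module_hom_add[OF braid_hom] module_hom_a_inv[OF _ _ braid_hom] braid_tensor)
      (simp add: braid_pure_def tensor_simps VS.M.braid_cancel')
qed

lemma braid_inv_braid:
  assumes "t \<in> carrier (tensor_space K S V)"
  shows "braid_inv S \<rho> (braid S \<rho> t) = t"
  by (rule module_hom_tensor3_eqI[OF S X_module X_module tensor_space_module[OF S V_module]
        module_hom_comp[OF braid_inv_hom braid_hom]
        module_hom_id[OF tensor_space_module[OF S V_module]] _ assms])
    (simp add: braid_tensor braid_inv_braid_pure)

lemma braid_braid_inv:
  assumes "t \<in> carrier (tensor_space K V S)"
  shows "braid S \<rho> (braid_inv S \<rho> t) = t"
proof (rule module_hom_tensor_eqI[OF V_module S module_hom_comp[OF braid_hom braid_inv_hom]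
        module_hom_id[OF tensor_space_module[OF V_module S]] _ assms])
  fix u s assume u: "u \<in> carrier V" and s: "s \<in> carrier S"
  \<comment> \<open>With \<open>s\<close> fixed both sides are linear in \<open>u\<close>, so
    \<open>u\<close> may be taken to be a pure tensor of elements of \<open>X\<close>.\<close>
  note h = tensor_hom_left[OF V_module S s]
  show "braid S \<rho> (braid_inv S \<rho> (tensor K V S u s)) = tensor K V S u s"
    by (rule module_hom_tensor_eqI[OF X_module X_module
          module_hom_comp[OF module_hom_comp[OF braid_hom braid_inv_hom] h] h _ u])
      (simp add: braid_inv_tensor braid_braid_inv_pure s)
qed

end

section \<open>Equivariance of the braiding\<close>

lemma D_tensor:
  "\<lbrakk>y \<in> carrier X; z \<in> carrier X; w \<in> carrier X\<rbrakk> \<Longrightarrow>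
    D y (tensor K X X z w) = tensor K X X (b z y) w \<oplus>\<^bsub>V\<^esub> tensor K X X z (b w y)"
  by (rule tensor_derivation_tensor[OF X_module X_module bilinear_map_left bilinear_map_left,
        OF b_bilinear _ b_bilinear])

lemma DD_tensor:
  "\<lbrakk>y \<in> carrier X; s \<in> carrier V; t \<in> carrier V\<rbrakk> \<Longrightarrow>
    DD y (tensor K V V s t) = tensor K V V (D y s) t \<oplus>\<^bsub>VV\<^esub> tensor K V V s (D y t)"
  by (rule tensor_derivation_tensor[OF V_module V_module action_hom action_hom,
        OF action_D _ action_D])

lemmas D_in = action_in[OF action_D]
lemmas DD_in = action_in[OF action_DD]
lemmas D_add = action_add[OF action_D]
lemmas DD_add = action_add[OF action_DD]

lemma braid_D_hom: "braid V D \<in> module_hom K VV VV"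
  by (rule braid_hom[OF V_module action_D])

text \<open>Moving \<open>D y\<close> inward past \<open>D z\<close> and \<open>D w\<close> creates
  terms with \<open>D (b z y)\<close> and \<open>D (b w y)\<close>. These are the terms that the
  braiding produces when \<open>y\<close> acts on \<open>z\<close> and \<open>w\<close> before the
  crossing; the copies of \<open>e\<close> contribute nothing because \<open>b e y\<close> is
  zero.\<close>

lemma braid_equivariant:
  assumes y: "y \<in> carrier X" and t: "t \<in> carrier VV"
  shows "braid V D (DD y t) = DD y (braid V D t)"
proof (rule module_hom_tensor3_eqI[OF V_module X_module X_module _
      module_hom_comp[OF braid_D_hom action_hom[OF action_DD y]]
      module_hom_comp[OF action_hom[OF action_DD y] braid_D_hom] _ t])
  show "module K VV" by simp
  fix s z w assume s: "s \<in> carrier V" and z: "z \<in> carrier X" and w: "w \<in> carrier X"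
  interpret V: module K V by (rule V_module)
  interpret VV: module K VV by simp
  note [simp] = D_in DD_in D_tensor DD_tensor D_add DD_add y s z w
  \<comment> \<open>The following three equations bring \<open>D y\<close> to the innermost
    position, a normal form in which both sides can be compared.\<close>
  have w': "D y (D w s) = D (b w y) s \<oplus>\<^bsub>V\<^esub> D w (D y s)"
    using action_comm[OF action_D] y w s by blast
  have z': "D y (D z s) = D (b z y) s \<oplus>\<^bsub>V\<^esub> D z (D y s)"
    using action_comm[OF action_D] y z s by blast
  have zw': "D y (D w (D z s))
      = D (b w y) (D z s) \<oplus>\<^bsub>V\<^esub> (D w (D (b z y) s) \<oplus>\<^bsub>V\<^esub> D w (D z (D y s)))"
    using action_comm[OF action_D y w D_in[OF z s]] by (simp add: z')
  show "braid V D (DD y (tensor K V V s (tensor K X X z w)))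
      = DD y (braid V D (tensor K V V s (tensor K X X z w)))"
    by (simp add: braid_tensor[OF V_module action_D] tensor_simps module_hom_add[OF braid_D_hom])
      (simp add: braid_pure_def w' z' zw' tensor_simps b_e_left VV.M.a_ac)
qed

section \<open>The Yang-Baxter equation\<close>

context
  fixes R
  assumes R: "\<And>t. t \<in> carrier VV \<Longrightarrow> R t = braid V D t"
begin

text \<open>\<open>R12\<close> and \<open>R23\<close> are the local operators \<open>R1\<close> and
  \<open>R2\<close> of \<open>yang_baxter_operator\<close>, acting on the first two and the last two
  factors.\<close>

definition R12 where
  "R12 = assoc_right K V V V \<circ> tensor_map K VV V VV V R id \<circ> assoc_left K V V V"

definition R23 where
  "R23 = tensor_map K V VV V VV id R"

lemma VV_module: "module K VV"
  by simp

text \<open>Only agreement with the braiding on the carrier is assumed of \<open>R\<close>, so that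
  the results apply to \<open>lie_R\<close>, which is built from other lifts. Linearity is inherited
  through this agreement.\<close>

lemma R_hom: "R \<in> module_hom K VV VV"
  by (rule module_hom_cong[OF braid_D_hom VV_module R])

lemma id_hom: "id \<in> module_hom K V V"
  using module_hom_id[OF V_module] by (simp add: id_def)

lemma R12_hom: "R12 \<in> module_hom K (tensor_space K V VV) (tensor_space K V VV)"
  unfolding R12_def comp_def
  by (rule module_hom_comp[OF assoc_right_hom[OF V_module V_module V_module]
        module_hom_comp[OF tensor_map_hom[OF VV_module V_module VV_module V_module R_hom id_hom]
          assoc_left_hom[OF V_module V_module V_module]]])

lemma R23_hom: "R23 \<in> module_hom K (tensor_space K V VV) (tensor_space K V VV)"
  unfolding R23_def
  by (rule tensor_map_hom[OF V_module VV_module V_module VV_module id_hom R_hom])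

lemma R12_tensor:
  assumes "s \<in> carrier V" "t \<in> carrier V" "u \<in> carrier V"
  shows "R12 (tensor K V VV s (tensor K V V t u))
    = assoc_right K V V V (tensor K VV V (braid V D (tensor K V V s t)) u)"
  using assms
  by (simp add: R12_def R assoc_left_tensor
      tensor_map_tensor[OF VV_module V_module VV_module V_module R_hom id_hom])

lemma R23_tensor:
  assumes "s \<in> carrier V" "t \<in> carrier VV"
  shows "R23 (tensor K V VV s t) = tensor K V VV s (braid V D t)"
  using assms
  by (simp add: R23_def R tensor_map_tensor[OF V_module VV_module V_module VV_module id_hom R_hom])

text \<open>Taking \<open>s \<otimes> t\<close> past \<open>u\<close> at once is the same as taking
  \<open>t\<close> past \<open>u\<close> and then \<open>s\<close> past the result. On pure tensors
  both sides have nine terms: the double diagonal action expands to four, and in the two successive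
  crossings every \<open>e\<close> left by the first acts as zero in the second.\<close>

lemma braid_hexagon:
  assumes t: "t \<in> carrier VV" and u: "u \<in> carrier V"
  shows "R12 (R23 (assoc_right K V V V (tensor K VV V t u))) = braid VV DD (tensor K VV V t u)"
proof -
  note ar_hom = assoc_right_hom[OF V_module V_module V_module]
  note lhs = module_hom_comp[OF R12_hom module_hom_comp[OF R23_hom ar_hom]]
  note rhs = braid_hom[OF VV_module action_DD]
  interpret V: module K V by (rule V_module)
  interpret VV: module K VV by simp
  interpret VVV: module K "tensor_space K V VV" by simp
  interpret VVV': module K "tensor_space K VV V" by simp
  note [simp] = D_in DD_in DD_tensor D_add DD_add
  have pure: "R12 (R23 (assoc_right K V V V (tensor K VV V (tensor K V V s t) (tensor K X X z w))))
      = braid VV DD (tensor K VV V (tensor K V V s t) (tensor K X X z w))"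
    if [simp]: "s \<in> carrier V" "t \<in> carrier V" "z \<in> carrier X" "w \<in> carrier X" for s t z w
    by (simp add: assoc_right_tensor R23_tensor braid_tensor[OF VV_module action_DD])
      (simp add: braid_pure_def tensor_simps module_hom_add[OF R12_hom] R12_tensor
        braid_tensor[OF V_module action_D] action_e[OF action_D]
        module_hom_add[OF ar_hom] assoc_right_tensor
        module_hom_zero[OF V_module V_module action_hom[OF action_D]] VVV.M.a_ac)
  have "R12 (R23 (assoc_right K V V V (tensor K VV V (tensor K V V s t) u)))
      = braid VV DD (tensor K VV V (tensor K V V s t) u)"
    if "s \<in> carrier V" "t \<in> carrier V" for s t
  proof -
    note h = tensor_hom_right[OF VV_module V_module tensor_in[OF V_module V_module that]]
    show ?thesis
      by (rule module_hom_tensor_eqI[OF X_module X_module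
            module_hom_comp[OF lhs h] module_hom_comp[OF rhs h] pure[OF that] u])
  qed
  then show ?thesis
    by (rule module_hom_tensor_eqI[OF V_module V_module
          module_hom_comp[OF lhs tensor_hom_left[OF VV_module V_module u]]
          module_hom_comp[OF rhs tensor_hom_left[OF VV_module V_module u]] _ t])
qed

text \<open>The braiding past \<open>u\<close> involves its other argument only through linearity
  and the action. Since \<open>R\<close> commutes with the diagonal action, it may be applied before
  or after the crossing.\<close>

lemma braid_natural:
  assumes t: "t \<in> carrier VV" and u: "u \<in> carrier V"
  shows "braid VV DD (tensor K VV V (braid V D t) u) = R23 (braid VV DD (tensor K VV V t u))"
proof -
  note rhs = braid_hom[OF VV_module action_DD]
  have t': "braid V D t \<in> carrier VV" by (rule module_hom_in[OF braid_D_hom t])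
  interpret VV: module K VV by simp
  interpret VVV: module K "tensor_space K V VV" by simp
  note [simp] = DD_in t t'
  have "braid VV DD (tensor K VV V (braid V D t) (tensor K X X z w))
      = R23 (braid VV DD (tensor K VV V t (tensor K X X z w)))"
    if [simp]: "z \<in> carrier X" "w \<in> carrier X" for z w
    by (simp add: braid_tensor[OF VV_module action_DD])
      (simp add: braid_pure_def module_hom_add[OF R23_hom] R23_tensor braid_equivariant)
  then show ?thesis
    by (rule module_hom_tensor_eqI[OF X_module X_module
          module_hom_comp[OF rhs tensor_hom_right[OF VV_module V_module t']]
          module_hom_comp[OF R23_hom module_hom_comp[OF rhs
            tensor_hom_right[OF VV_module V_module t]]] _ u])
qed

text \<open>On \<open>s \<otimes> (t \<otimes> u)\<close>, the first \<open>R12\<close> acts on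
  \<open>s \<otimes> t\<close>, and \<open>R23\<close> followed by \<open>R12\<close> is the
  crossing of this pair past \<open>u\<close>. Naturality moves the first operator behind the
  crossing, where it acts as \<open>R23\<close>.\<close>

lemma R_yang_baxter:
  assumes t: "t \<in> carrier (tensor_space K V VV)"
  shows "R12 (R23 (R12 t)) = R23 (R12 (R23 t))"
proof (rule module_hom_tensor3_eqI[OF V_module V_module V_module _
      module_hom_comp[OF R12_hom module_hom_comp[OF R23_hom R12_hom]]
      module_hom_comp[OF R23_hom module_hom_comp[OF R12_hom R23_hom]] _ t])
  show "module K (tensor_space K V VV)" by simp
  fix s t u assume m: "s \<in> carrier V" "t \<in> carrier V" "u \<in> carrier V"
  then have st: "tensor K V V s t \<in> carrier VV" by simp
  have "R12 (R23 (R12 (tensor K V VV s (tensor K V V t u))))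
      = braid VV DD (tensor K VV V (braid V D (tensor K V V s t)) u)"
    by (simp add: R12_tensor m braid_hexagon module_hom_in[OF braid_D_hom st])
  \<comment> \<open>Naturality first, and then \<open>braid_hexagon\<close> read from right to
    left.\<close>
  also have "\<dots> = R23 (R12 (R23 (assoc_right K V V V (tensor K VV V (tensor K V V s t) u))))"
    by (simp add: braid_natural st m braid_hexagon)
  also have "\<dots> = R23 (R12 (R23 (tensor K V VV s (tensor K V V t u))))"
    by (simp add: assoc_right_tensor m)
  finally show "R12 (R23 (R12 (tensor K V VV s (tensor K V V t u))))
    = R23 (R12 (R23 (tensor K V VV s (tensor K V V t u))))" .
qed

text \<open>The inverse is \<open>braid_inv V D\<close>. Invertibility is expressed with module
  homomorphisms since the locale works over a commutative ring.\<close>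

lemma R_invertible: "\<exists>g\<in>module_hom K VV VV. \<forall>t\<in>carrier VV. g (R t) = t \<and> R (g t) = t"
proof (rule bexI[OF _ braid_inv_hom[OF V_module action_D]], rule ballI)
  fix t assume t: "t \<in> carrier VV"
  then show "braid_inv V D (R t) = t \<and> R (braid_inv V D t) = t"
    using module_hom_in[OF braid_inv_hom[OF V_module action_D] t]
    by (simp add: R braid_inv_braid[OF V_module action_D] braid_braid_inv[OF V_module action_D])
qed

end

end

section \<open>The operator of a Lie algebra\<close>

lemma scalar_space_module:
  assumes "cring K"
  shows "module K (scalar_space K)"
proof -
  interpret cring K by fact
  show ?thesis
    by (rule module_criteria)
      (auto simp: scalar_space_def a_ac m_assoc l_distr r_distr is_cring
        intro!: bexI[of _ "\<ominus>\<^bsub>K\<^esub> _"] r_neg)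
qed

context lie_algebra
begin

abbreviation X where "X \<equiv> lie_X K L"
abbreviation e where "e \<equiv> (\<one>\<^bsub>K\<^esub>, \<zero>\<^bsub>L\<^esub>)"
abbreviation lie_part :: "'a \<times> 'c \<Rightarrow> 'a \<times> 'c" where "lie_part z \<equiv> (\<zero>\<^bsub>K\<^esub>, snd z)"

definition X_bracket :: "'a \<times> 'c \<Rightarrow> 'a \<times> 'c \<Rightarrow> 'a \<times> 'c" where
  "X_bracket x z = (\<zero>\<^bsub>K\<^esub>, br (snd x) (snd z))"

lemma lie_X_simps:
  "carrier X = carrier K \<times> carrier L"
  "\<zero>\<^bsub>X\<^esub> = (\<zero>\<^bsub>K\<^esub>, \<zero>\<^bsub>L\<^esub>)"
  "x \<oplus>\<^bsub>X\<^esub> y = (fst x \<oplus>\<^bsub>K\<^esub> fst y, snd x \<oplus>\<^bsub>L\<^esub> snd y)"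
  "c \<odot>\<^bsub>X\<^esub> x = (c \<otimes>\<^bsub>K\<^esub> fst x, c \<odot>\<^bsub>L\<^esub> snd x)"
  by (simp_all add: lie_X_def direct_sum_def scalar_space_def)

lemma lie_X_module: "module K X"
  unfolding lie_X_def
  by (intro direct_sum_is_module scalar_space_module module_axioms R.is_cring)

section \<open>Consequences of the Lie algebra axioms\<close>

lemma br_zero_left: "x \<in> carrier L \<Longrightarrow> br \<zero>\<^bsub>L\<^esub> x = \<zero>\<^bsub>L\<^esub>"
  using br_smult_left[of "\<zero>\<^bsub>K\<^esub>" "\<zero>\<^bsub>L\<^esub>" x] br_closed[of "\<zero>\<^bsub>L\<^esub>" x] by simp

lemma br_zero_right: "x \<in> carrier L \<Longrightarrow> br x \<zero>\<^bsub>L\<^esub> = \<zero>\<^bsub>L\<^esub>"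
  using br_smult_right[of "\<zero>\<^bsub>K\<^esub>" x "\<zero>\<^bsub>L\<^esub>"] br_closed[of x "\<zero>\<^bsub>L\<^esub>"] by simp

text \<open>Polarization of the alternating law at the sum of \<open>x\<close> and
  \<open>y\<close>.\<close>

lemma br_skew:
  assumes x: "x \<in> carrier L" and y: "y \<in> carrier L"
  shows "br y x = \<ominus>\<^bsub>L\<^esub> br x y"
proof -
  have "br (x \<oplus>\<^bsub>L\<^esub> y) (x \<oplus>\<^bsub>L\<^esub> y)
      = (br x x \<oplus>\<^bsub>L\<^esub> br x y) \<oplus>\<^bsub>L\<^esub> (br y x \<oplus>\<^bsub>L\<^esub> br y y)"
    using x y by (simp add: br_add_left br_add_right br_closed M.a_ac)
  then have "br y x \<oplus>\<^bsub>L\<^esub> br x y = \<zero>\<^bsub>L\<^esub>"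
    using x y br_alternating[of "x \<oplus>\<^bsub>L\<^esub> y"] by (simp add: br_closed br_alternating M.a_comm)
  then show ?thesis using x y by (intro M.minus_equality[symmetric]) (simp_all add: br_closed)
qed

lemma br_uminus_left:
  assumes x: "x \<in> carrier L" and y: "y \<in> carrier L"
  shows "br (\<ominus>\<^bsub>L\<^esub> x) y = \<ominus>\<^bsub>L\<^esub> br x y"
proof -
  have "br (\<ominus>\<^bsub>L\<^esub> x) y \<oplus>\<^bsub>L\<^esub> br x y = br (\<ominus>\<^bsub>L\<^esub> x \<oplus>\<^bsub>L\<^esub> x) y"
    using x y by (simp add: br_add_left)
  also have "\<dots> = \<zero>\<^bsub>L\<^esub>" using x y by (simp add: M.l_neg br_zero_left)
  finally show ?thesis using x y by (intro M.minus_equality[symmetric]) (simp_all add: br_closed)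
qed

text \<open>The Jacobi identity for \<open>x\<close>, \<open>z\<close>, \<open>y\<close> in this
  order. Skew-symmetry turns its second term into \<open>[[x, y], z]\<close> and its third into
  minus \<open>[[x, z], y]\<close>.\<close>

lemma br_leibniz:
  assumes x: "x \<in> carrier L" and y: "y \<in> carrier L" and z: "z \<in> carrier L"
  shows "br x (br z y) \<oplus>\<^bsub>L\<^esub> br (br x y) z = br (br x z) y"
proof -
  have 1: "br z (br y x) = br (br x y) z"
    using x y z br_skew[of "br y x" z] br_skew[of x y] by (simp add: br_closed br_uminus_left)
  have 2: "br y (br x z) = \<ominus>\<^bsub>L\<^esub> br (br x z) y"
    using x y z by (intro br_skew) (simp_all add: br_closed)
  have "br x (br z y) \<oplus>\<^bsub>L\<^esub> br (br x y) z \<oplus>\<^bsub>L\<^esub> \<ominus>\<^bsub>L\<^esub> br (br x z) y = \<zero>\<^bsub>L\<^esub>"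
    using br_jacobi[OF x z y] unfolding 1 2 .
  then show ?thesis
    using x y z M.minus_other_side by (simp add: a_minus_def br_closed)
qed

lemma e_in_X: "e \<in> carrier X"
  by (simp add: lie_X_simps)

lemma lie_part_hom: "lie_part \<in> module_hom K X X"
  by (rule module_homI) (auto simp: lie_X_simps)

lemma X_bracket_bilinear: "bilinear_map K X X X X_bracket"
  by (intro bilinear_mapI module_homI)
    (auto simp: X_bracket_def lie_X_simps br_closed br_add_left br_add_right br_smult_left br_smult_right)

lemma central_leibniz: "central_leibniz K X X_bracket e"
proof -
  interpret X: module K X by (rule lie_X_module)
  show ?thesis
    by unfold_locales
      (auto simp: X_bracket_bilinear e_in_X X_bracket_def lie_X_simps br_zero_left br_zero_right br_leibniz br_closed)
qed

sublocale X: central_leibniz K X X_bracket e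
  by (rule central_leibniz)

section \<open>Evaluation of Sweedler sums\<close>

definition trilinear_map ::
  "('a, 'z, 'n) module_scheme \<Rightarrow> ('a \<times> 'c \<Rightarrow> 'a \<times> 'c \<Rightarrow> 'a \<times> 'c \<Rightarrow> 'z) \<Rightarrow> bool" where
  "trilinear_map Z F \<longleftrightarrow>
     (\<forall>u\<in>carrier X. \<forall>v\<in>carrier X. F u v \<in> module_hom K X Z) \<and>
     (\<forall>u\<in>carrier X. \<forall>w\<in>carrier X. (\<lambda>v. F u v w) \<in> module_hom K X Z) \<and>
     (\<forall>v\<in>carrier X. \<forall>w\<in>carrier X. (\<lambda>u. F u v w) \<in> module_hom K X Z)"

context
  fixes Z :: "('a, 'z, 'n) module_scheme" and F
  assumes Z: "module K Z" and F: "trilinear_map Z F"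
begin

lemma lie_lift3_aux:
  "bilinear_map K X (X.V) Z (\<lambda>u. tensor_lift K X X Z (F u))"
  "u \<in> carrier X \<Longrightarrow> bilinear_map K X X Z (F u)"
proof -
  show B: "bilinear_map K X X Z (F u)" if "u \<in> carrier X" for u
    using F that by (intro bilinear_mapI) (auto simp: trilinear_map_def)
  show "bilinear_map K X (X.V) Z (\<lambda>u. tensor_lift K X X Z (F u))"
    using F by (intro bilinear_map_tensor_lift_right lie_X_module Z B)
      (auto simp: trilinear_map_def)
qed

lemma lie_lift3_hom: "lie_lift3 K L Z F \<in> module_hom K (lie_X3 K L) Z"
  unfolding lie_lift3_def by (rule tensor_lift_hom[OF lie_X_module X.V_module Z lie_lift3_aux(1)])

lemma lie_lift3_tensor:
  "\<lbrakk>u \<in> carrier X; v \<in> carrier X; w \<in> carrier X\<rbrakk> \<Longrightarrow>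
    lie_lift3 K L Z F (tensor K X (lie_X2 K L) u (tensor K X X v w)) = F u v w"
  unfolding lie_lift3_def
  by (simp add: tensor_lift_tensor[OF lie_X_module X.V_module Z lie_lift3_aux(1)]
      tensor_lift_tensor[OF lie_X_module lie_X_module Z lie_lift3_aux(2)])

end

lemma lie_Delta_eq:
  "lie_Delta K L z = tensor K X X z e \<oplus>\<^bsub>lie_X2 K L\<^esub> tensor K X X e (lie_part z)"
  by (cases z) (simp add: lie_Delta_def)

lemma lie_Delta_hom: "lie_Delta K L \<in> module_hom K X (lie_X2 K L)"
proof -
  note h = tensor_hom_left[OF lie_X_module lie_X_module e_in_X]
    module_hom_comp[OF tensor_hom_right[OF lie_X_module lie_X_module e_in_X] lie_part_hom]
  show ?thesis
    by (rule module_hom_cong[OF module_hom_plus[OF X.V_module h] lie_X_module lie_Delta_eq])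
qed

text \<open>Applying the comultiplication to the second factor of
  \<open>z \<otimes> e + e \<otimes> z'\<close> splits the second term once more, while the first
  stays a single term because \<open>e\<close> is grouplike.\<close>

lemma lie_Delta3_eq:
  assumes z: "z \<in> carrier X"
  shows "lie_Delta3 K L z =
    tensor K X (lie_X2 K L) z (tensor K X X e e) \<oplus>\<^bsub>lie_X3 K L\<^esub>
    (tensor K X (lie_X2 K L) e (tensor K X X (lie_part z) e) \<oplus>\<^bsub>lie_X3 K L\<^esub>
     tensor K X (lie_X2 K L) e (tensor K X X e (lie_part z)))"
proof -
  have id: "id \<in> module_hom K X X" using module_hom_id[OF lie_X_module] by (simp add: id_def)
  interpret X: module K X by (rule lie_X_module)
  interpret V: module K "lie_X2 K L" by (rule X.V_module)
  interpret X3: module K "lie_X3 K L" by simp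
  have lz: "lie_part z \<in> carrier X" by (rule module_hom_in[OF lie_part_hom z])
  \<comment> \<open>The Lie part of \<open>e\<close> vanishes, which is why its comultiplication is
    \<open>e \<otimes> e\<close>.\<close>
  have le: "lie_part e = \<zero>\<^bsub>X\<^esub>" by (simp add: lie_X_simps)
  note D = lie_X_module lie_X_module lie_X_module X.V_module id lie_Delta_hom
  show ?thesis
    using z lz e_in_X
    by (simp add: lie_Delta3_def lie_Delta_eq[of z] module_hom_add[OF tensor_map_hom[OF D]]
        tensor_map_tensor[OF D])
      (simp add: lie_Delta_eq tensor_simps le[simplified])
qed

text \<open>Replaces a Sweedler sum by three evaluations: \<open>z\<close> in the first place, or
  its Lie part in the second or third, with \<open>e\<close> elsewhere.\<close>

lemma lie_lift3_Delta3:
  assumes Z: "module K Z" and F: "trilinear_map Z F" and z: "z \<in> carrier X"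
  shows "lie_lift3 K L Z F (lie_Delta3 K L z) =
    F z e e \<oplus>\<^bsub>Z\<^esub> (F e (lie_part z) e \<oplus>\<^bsub>Z\<^esub> F e e (lie_part z))"
proof -
  interpret X3: module K "lie_X3 K L" by simp
  have lz: "lie_part z \<in> carrier X" by (rule module_hom_in[OF lie_part_hom z])
  show ?thesis
    using z lz e_in_X
    by (simp add: lie_Delta3_eq module_hom_add[OF lie_lift3_hom[OF Z F]] lie_lift3_tensor[OF Z F])
qed

section \<open>The ternary operation on pure tensors\<close>

definition T_pure :: "'a \<times> 'c \<Rightarrow> 'a \<times> 'c \<Rightarrow> 'a \<times> 'c \<Rightarrow> 'a \<times> 'c" where
  "T_pure p q r = lie_T K L br (tensor K X (lie_X2 K L) p (tensor K X X q r))"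

text \<open>Written with projections instead of patterns on pairs, so that linearity in each
  argument becomes a componentwise calculation.\<close>

definition T_formula :: "'a \<times> 'c \<Rightarrow> 'a \<times> 'c \<Rightarrow> 'a \<times> 'c \<Rightarrow> 'a \<times> 'c" where
  "T_formula p q r = (fst p \<otimes>\<^bsub>K\<^esub> fst q \<otimes>\<^bsub>K\<^esub> fst r,
     (fst q \<otimes>\<^bsub>K\<^esub> fst r) \<odot>\<^bsub>L\<^esub> snd p \<oplus>\<^bsub>L\<^esub> fst r \<odot>\<^bsub>L\<^esub> br (snd p) (snd q) \<oplus>\<^bsub>L\<^esub>
     fst q \<odot>\<^bsub>L\<^esub> br (snd p) (snd r) \<oplus>\<^bsub>L\<^esub> br (br (snd p) (snd q)) (snd r))"

lemma T_formula_trilinear: "trilinear_map X T_formula"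
  unfolding trilinear_map_def
  by (intro conjI ballI module_homI)
    (auto simp: T_formula_def lie_X_simps br_closed br_add_left br_add_right br_smult_left br_smult_right
      R.l_distr R.r_distr smult_l_distr smult_r_distr M.a_ac R.m_ac smult_assoc1[symmetric])

lemma T_pure_eq:
  assumes "p \<in> carrier X" "q \<in> carrier X" "r \<in> carrier X"
  shows "T_pure p q r = T_formula p q r"
proof -
  have "lie_T K L br = lie_lift3 K L X T_formula"
    unfolding lie_T_def T_formula_def[abs_def] by (simp add: case_prod_beta')
  then show ?thesis
    using assms by (simp add: T_pure_def lie_lift3_tensor[OF lie_X_module T_formula_trilinear])
qed

lemma T_pure_hom2: "\<lbrakk>u \<in> carrier X; w \<in> carrier X\<rbrakk> \<Longrightarrow> (\<lambda>v. T_pure u v w) \<in> module_hom K X X"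
  and T_pure_hom3: "\<lbrakk>u \<in> carrier X; v \<in> carrier X\<rbrakk> \<Longrightarrow> (\<lambda>w. T_pure u v w) \<in> module_hom K X X"
proof -
  note t = T_formula_trilinear[unfolded trilinear_map_def]
  show "(\<lambda>v. T_pure u v w) \<in> module_hom K X X" if m: "u \<in> carrier X" "w \<in> carrier X"
    by (rule module_hom_cong[OF _ lie_X_module T_pure_eq[OF m(1) _ m(2)]]) (use t m in blast)
  show "(\<lambda>w. T_pure u v w) \<in> module_hom K X X" if m: "u \<in> carrier X" "v \<in> carrier X"
    by (rule module_hom_cong[OF _ lie_X_module T_pure_eq[OF m]]) (use t m in blast)
qed

lemma T_pure_in: "\<lbrakk>u \<in> carrier X; v \<in> carrier X; w \<in> carrier X\<rbrakk> \<Longrightarrow> T_pure u v w \<in> carrier X"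
  using module_hom_in[OF T_pure_hom3] .

text \<open>These arguments suffice for the operator, because the second and third Sweedler
  components are always \<open>e\<close> or Lie parts. The operation then reduces to the identity,
  one bracket or two successive brackets.\<close>

lemma T_pure_values:
  assumes "x \<in> carrier X" "z \<in> carrier X" "w \<in> carrier X"
  shows "T_pure x e e = x" "T_pure x (lie_part z) e = X_bracket x z" "T_pure x e (lie_part w) = X_bracket x w"
    "T_pure x (lie_part z) (lie_part w) = X_bracket (X_bracket x z) w"
  using assms by (auto simp: lie_X_simps T_pure_eq T_formula_def X_bracket_def br_closed br_zero_right br_zero_left)

section \<open>Identification of the operator with the braiding\<close>

text \<open>The two Sweedler sums give nine terms, one for each choice of the places that receive
  \<open>z\<close> and \<open>w\<close>. Grouped by whether each stays in the first place or acts on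
  \<open>x \<otimes> y\<close>, they number one, two, two and four, and each group is one summand of
  the braiding.\<close>

lemma lie_R_pure_eq:
  assumes x: "x \<in> carrier X" and y: "y \<in> carrier X" and z: "z \<in> carrier X" and w: "w \<in> carrier X"
  shows "lie_R_pure K L br x y z w = X.braid_pure X.V X.D (tensor K X X x y) z w"
proof -
  let ?X2 = "lie_X2 K L" and ?X4 = "lie_X4 K L"
  interpret V: module K ?X2 by (rule X.V_module)
  interpret X4: module K ?X4 by simp
  define G where "G z1 z2 z3 w1 w2 w3 =
    tensor K ?X2 ?X2 (tensor K X X z1 w1) (tensor K X X (T_pure x z2 w2) (T_pure y z3 w3))"
    for z1 z2 z3 w1 w2 w3
  note XX = lie_X_module lie_X_module and VV = X.V_module X.V_module
  \<comment> \<open>Each pair concerns a component of \<open>w\<close> and the matching component of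
    \<open>z\<close>. In the second fact of a pair, the variable named after the varied component of
    \<open>z\<close> is free to serve elsewhere; in \<open>G1\<close> it fills the place of the
    first component of \<open>w\<close>.\<close>
  have G1: "(\<lambda>p. G z1 z2 z3 p w2 w3) \<in> module_hom K X ?X4"
      "(\<lambda>p. G p z2 z3 z1 w2 w3) \<in> module_hom K X ?X4"
    and G2: "(\<lambda>p. G z1 z2 z3 w1 p w3) \<in> module_hom K X ?X4"
      "(\<lambda>p. G z1 p z3 w1 w2 w3) \<in> module_hom K X ?X4"
    and G3: "(\<lambda>p. G z1 z2 z3 w1 w2 p) \<in> module_hom K X ?X4"
      "(\<lambda>p. G z1 z2 p w1 w2 w3) \<in> module_hom K X ?X4"
    if m: "z1 \<in> carrier X" "z2 \<in> carrier X" "z3 \<in> carrier X"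
      "w1 \<in> carrier X" "w2 \<in> carrier X" "w3 \<in> carrier X" for z1 z2 z3 w1 w2 w3
  proof -
    note t1 = tensor_in[OF XX m(1,4)]
    note t2 = T_pure_in[OF x m(2,5)] and t3 = T_pure_in[OF y m(3,6)]
    note h = tensor_hom_left[OF VV tensor_in[OF XX t2 t3]]
    note l = module_hom_comp[OF tensor_hom_right[OF VV t1] tensor_hom_left[OF XX t3]]
    note r = module_hom_comp[OF tensor_hom_right[OF VV t1] tensor_hom_right[OF XX t2]]
    show "(\<lambda>p. G z1 z2 z3 p w2 w3) \<in> module_hom K X ?X4"
      and "(\<lambda>p. G p z2 z3 z1 w2 w3) \<in> module_hom K X ?X4"
      unfolding G_def
      by (rule module_hom_comp[OF h tensor_hom_right[OF XX m(1)]]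
          module_hom_comp[OF h tensor_hom_left[OF XX m(1)]])+
    show "(\<lambda>p. G z1 z2 z3 w1 p w3) \<in> module_hom K X ?X4"
      and "(\<lambda>p. G z1 p z3 w1 w2 w3) \<in> module_hom K X ?X4"
      unfolding G_def
      by (rule module_hom_comp[OF l T_pure_hom3[OF x m(2)]] module_hom_comp[OF l T_pure_hom2[OF x m(5)]])+
    show "(\<lambda>p. G z1 z2 z3 w1 w2 p) \<in> module_hom K X ?X4"
      and "(\<lambda>p. G z1 z2 p w1 w2 w3) \<in> module_hom K X ?X4"
      unfolding G_def
      by (rule module_hom_comp[OF r T_pure_hom3[OF y m(3)]] module_hom_comp[OF r T_pure_hom2[OF y m(6)]])+
  qed
  have Gw: "trilinear_map ?X4 (G z1 z2 z3)"
    if that: "z1 \<in> carrier X" "z2 \<in> carrier X" "z3 \<in> carrier X" for z1 z2 z3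
    unfolding trilinear_map_def
  proof (intro conjI ballI)
    fix u v assume m: "u \<in> carrier X" "v \<in> carrier X"
    \<comment> \<open>Here and in the next two goals \<open>e_in_X\<close> is a dummy for the
      argument that varies.\<close>
    show "G z1 z2 z3 u v \<in> module_hom K X ?X4" by (rule G3(1)[OF that m e_in_X])
    show "(\<lambda>p. G z1 z2 z3 u p v) \<in> module_hom K X ?X4" by (rule G2(1)[OF that m(1) e_in_X m(2)])
    show "(\<lambda>p. G z1 z2 z3 p u v) \<in> module_hom K X ?X4" by (rule G1(1)[OF that e_in_X m])
  qed
  \<comment> \<open>The inner Sweedler sum over \<open>w\<close>, as a function of the components of
    \<open>z\<close>. Its trilinearity is what permits the evaluation of the outer sum.\<close>
  define H where "H z1 z2 z3 = lie_lift3 K L ?X4 (G z1 z2 z3) (lie_Delta3 K L w)" for z1 z2 z3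
  have lw: "lie_part w \<in> carrier X" and lz: "lie_part z \<in> carrier X"
    using module_hom_in[OF lie_part_hom] z w by blast+
  have H: "H z1 z2 z3 = G z1 z2 z3 w e e \<oplus>\<^bsub>?X4\<^esub>
      (G z1 z2 z3 e (lie_part w) e \<oplus>\<^bsub>?X4\<^esub> G z1 z2 z3 e e (lie_part w))"
    if "z1 \<in> carrier X" "z2 \<in> carrier X" "z3 \<in> carrier X" for z1 z2 z3
    unfolding H_def by (rule lie_lift3_Delta3[OF X4.module_axioms Gw[OF that] w])
  note sum = module_hom_plus[OF X4.module_axioms _ module_hom_plus[OF X4.module_axioms]]
  have Ht: "trilinear_map ?X4 H"
    unfolding trilinear_map_def
  proof (intro conjI ballI)
    fix u v assume m: "u \<in> carrier X" "v \<in> carrier X"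
    show "H u v \<in> module_hom K X ?X4"
      by (rule module_hom_cong[OF sum lie_X_module H[OF m]])
        (rule G3(2); fact m w lw e_in_X)+
    show "(\<lambda>p. H u p v) \<in> module_hom K X ?X4"
      by (rule module_hom_cong[OF sum lie_X_module H[OF m(1) _ m(2)]])
        (rule G2(2); fact m w lw e_in_X)+
    show "(\<lambda>p. H p u v) \<in> module_hom K X ?X4"
      by (rule module_hom_cong[OF sum lie_X_module H[OF _ m]])
        (rule G1(2); fact m w lw e_in_X)+
  qed
  have "lie_R_pure K L br x y z w = lie_lift3 K L ?X4 H (lie_Delta3 K L z)"
    unfolding lie_R_pure_def Let_def H_def[abs_def] G_def[abs_def] T_pure_def ..
  also have "\<dots> = H z e e \<oplus>\<^bsub>?X4\<^esub> (H e (lie_part z) e \<oplus>\<^bsub>?X4\<^esub> H e e (lie_part z))"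
    by (rule lie_lift3_Delta3[OF X4.module_axioms Ht z])
  also have "\<dots> = X.braid_pure X.V X.D (tensor K X X x y) z w"
    using x y z w e_in_X lz lw
    by (simp add: H G_def T_pure_values X.braid_pure_def X.D_tensor X.D_add tensor_simps X.b_in X4.M.a_ac)
  finally show ?thesis .
qed

text \<open>The lifts in the definition are resolved from the inside out: each agrees on pure
  tensors with the braiding composed with a partially applied tensor, hence everywhere on its
  carrier.\<close>

lemma lie_R_eq_braid:
  assumes t: "t \<in> carrier (lie_X4 K L)"
  shows "lie_R K L br t = X.braid X.V X.D t"
proof -
  let ?X2 = "lie_X2 K L" and ?X4 = "lie_X4 K L"
  have Z: "module K ?X4" by simp
  note h = X.braid_D_hom
  note XX = lie_X_module lie_X_module and VV = X.V_module X.V_module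
  have 1: "tensor_lift K X X ?X4 (lie_R_pure K L br x y) t
      = X.braid X.V X.D (tensor K ?X2 ?X2 (tensor K X X x y) t)"
    if xy: "x \<in> carrier X" "y \<in> carrier X" and t: "t \<in> carrier ?X2" for x y t
    by (rule tensor_lift_unique[OF XX Z
          module_hom_comp[OF h tensor_hom_right[OF VV tensor_in[OF XX xy]]] _ t])
      (simp add: lie_R_pure_eq X.braid_tensor[OF X.V_module X.action_D] xy)
  have 2: "tensor_lift K X X ?X4 (\<lambda>x y. tensor_lift K X X ?X4 (lie_R_pure K L br x y) t) s
      = X.braid X.V X.D (tensor K ?X2 ?X2 s t)"
    if s: "s \<in> carrier ?X2" and t: "t \<in> carrier ?X2" for s t
    by (rule tensor_lift_unique[OF XX Z module_hom_comp[OF h tensor_hom_left[OF VV t]] _ s])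
      (simp add: 1 t)
  show ?thesis
    unfolding lie_R_def Let_def by (rule tensor_lift_unique[OF VV Z h 2 t])
qed

end

theorem theorem3p9:
  fixes K :: "('k, 'm) ring_scheme"
    and L :: "('k, 'l, 'n) module_scheme"
    and br :: "'l \<Rightarrow> 'l \<Rightarrow> 'l"
  assumes "lie_algebra K L br"
  shows "invertible_linear_map K (lie_X4 K L) (lie_X4 K L) (lie_R K L br)
    \<and> yang_baxter_operator K (lie_X2 K L) (lie_R K L br)"
proof -
  interpret lie_algebra K L br by fact
  have vs: "vectorspace K (lie_X4 K L)"
    by (intro vectorspace.intro tensor_space_module lie_X_module field_axioms)
  \<comment> \<open>The predicate \<open>linear_map\<close> asks for vector spaces, so the
    homomorphism property is combined with \<open>vs\<close>.\<close>
  have lin: "linear_map K (lie_X4 K L) (lie_X4 K L) f"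
    if "f \<in> module_hom K (lie_X4 K L) (lie_X4 K L)" for f
    using that vs
    by (simp add: linear_map_def mod_hom_def mod_hom_axioms_def vectorspace_def)
  obtain g where g: "g \<in> module_hom K (lie_X4 K L) (lie_X4 K L)"
    "\<forall>t\<in>carrier (lie_X4 K L). g (lie_R K L br t) = t \<and> lie_R K L br (g t) = t"
    using X.R_invertible[OF lie_R_eq_braid] ..
  have inv: "invertible_linear_map K (lie_X4 K L) (lie_X4 K L) (lie_R K L br)"
    unfolding invertible_linear_map_def
  proof (intro conjI exI)
    show "linear_map K (lie_X4 K L) (lie_X4 K L) (lie_R K L br)"
      by (rule lin[OF X.R_hom[OF lie_R_eq_braid]])
    show "linear_map K (lie_X4 K L) (lie_X4 K L) g" by (rule lin[OF g(1)])
  qed (use g(2) in simp_all)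
  moreover have "yang_baxter_operator K (lie_X2 K L) (lie_R K L br)"
    unfolding yang_baxter_operator_def Let_def
    using inv X.R_yang_baxter[OF lie_R_eq_braid]
    \<comment> \<open>Unfolding \<open>R12\<close> and \<open>R23\<close> yields the two composites
      in the definition of a Yang-Baxter operator, with \<open>lie_R\<close> in place of
      \<open>R\<close>.\<close>
    by (simp add: X.R12_def[OF lie_R_eq_braid] X.R23_def[OF lie_R_eq_braid])
  ultimately show ?thesis ..
qed

end
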